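(* Let $\Pi_1,\Pi_2$ be hereditary graph classes whose associated forbidden families $\mathcal F_1,\mathcal F_2$ are both finite, and suppose that for a fixed integer $\alpha$ the path $P_\alpha$ on $\alpha$ vertices belongs to $\mathcal F_1$. For $i\in\{1,2\}$ let $d_i$ be the maximum number of vertices of a graph in $\mathcal F_i$, and let $c=d_1+d_2+\alpha-2$. Then there is an algorithm that, given an undirected graph $G$ on $n$ vertices and an integer $k$, decides in time $c^k\cdot n^{O(1)}$ whether there is a set $S\subseteq V(G)$ of at most $k$ vertices such that every connected component of $G-S$ is in $\Pi_1$ or in $\Pi_2$.
   Context: All graphs are finite, simple and undirected. A graph class is hereditary if it is closed under taking induced subgraphs. For $i\in\{1,2\}$, the forbidden family $\mathcal F_i$ associated to $\Pi_i$ is a family of graphs such that a graph has all of its connected components in $\Pi_i$ if and only if it contains no member of $\mathcal F_i$ as an induced subgraph. It is assumed throughout that all graphs in $\mathcal F_1$ and $\mathcal F_2$ are connected. Different components of $G-S$ may belong to different classes. The families $\mathcal F_1,\mathcal F_2$ and $\alpha$ are fixed (not part of the input). *)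

theory Defs
  imports "Graph_Theory.Graph_Theory"
begin

section \<open>Graphs and graph classes\<close>

text \<open>
  A finite simple undirected graph is a \<open>pair_graph\<close>: a finite vertex set with a symmetric
  irreflexive set of arcs (so an undirected edge is a pair of opposite arcs). The empty graph is
  a graph, but it is not \<open>connected\<close>. Up to isomorphism, natural numbers suffice as vertices.
\<close>

type_synonym ugraph = "nat pair_pre_digraph"

abbreviation isomorphic :: "ugraph \<Rightarrow> ugraph \<Rightarrow> bool" where
  "isomorphic G H \<equiv> digraph_iso (with_proj G) (with_proj H)"

text \<open>In a symmetric digraph the strongly connected components are the connected components.\<close>

definition components :: "ugraph \<Rightarrow> ugraph set" where
  "components G = {C. with_proj C \<in> pre_digraph.sccs (with_proj G)}"

definition delete_verts :: "ugraph \<Rightarrow> nat set \<Rightarrow> ugraph" where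
  "delete_verts G S = \<lparr> pverts = pverts G - S, parcs = {(u, v) \<in> parcs G. u \<notin> S \<and> v \<notin> S} \<rparr>"

definition contains_induced :: "ugraph \<Rightarrow> ugraph \<Rightarrow> bool" where
  "contains_induced G H \<longleftrightarrow>
     (\<exists>K. induced_subgraph (with_proj K) (with_proj G) \<and> isomorphic H K)"

definition path_graph :: "nat \<Rightarrow> ugraph" where
  "path_graph m = \<lparr> pverts = {..<m}, parcs = {(i, j). i < m \<and> j < m \<and> (j = Suc i \<or> i = Suc j)} \<rparr>"

definition graph_class :: "ugraph set \<Rightarrow> bool" where
  "graph_class \<P> \<longleftrightarrow> (\<forall>G\<in>\<P>. pair_graph G) \<and> (\<forall>G\<in>\<P>. \<forall>H. pair_graph H \<and> isomorphic G H \<longrightarrow> H \<in> \<P>)"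

definition hereditary :: "ugraph set \<Rightarrow> bool" where
  "hereditary \<P> \<longleftrightarrow> (\<forall>G\<in>\<P>. \<forall>H. induced_subgraph (with_proj H) (with_proj G) \<longrightarrow> H \<in> \<P>)"

definition forbidden_family :: "ugraph set \<Rightarrow> ugraph set \<Rightarrow> bool" where
  "forbidden_family \<P> F \<longleftrightarrow> (\<forall>H\<in>F. pair_graph H) \<and>
     (\<forall>G. pair_graph G \<longrightarrow>
        ((\<forall>C\<in>components G. C \<in> \<P>) \<longleftrightarrow> \<not> (\<exists>H\<in>F. contains_induced G H)))"

definition max_order :: "ugraph set \<Rightarrow> nat" where
  "max_order F = Max ((\<lambda>H. card (pverts H)) ` F)"

definition deletable :: "ugraph set \<Rightarrow> ugraph set \<Rightarrow> ugraph \<Rightarrow> nat \<Rightarrow> bool" where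
  "deletable \<P>1 \<P>2 G k \<longleftrightarrow>
     (\<exists>S \<subseteq> pverts G. card S \<le> k \<and> (\<forall>C\<in>components (delete_verts G S). C \<in> \<P>1 \<or> C \<in> \<P>2))"


section \<open>Machine model\<close>

text \<open>
  Structured programs for a random access machine with uniform cost. A program can mention only
  finitely many registers; the memory is an unbounded array of natural numbers that is accessed
  through addresses held in registers. Arithmetic is limited to increment and decrement, so a
  run of \<open>t\<close> steps creates no number larger than the maximum of the input numbers and the program
  constants plus \<open>t\<close>: unit-cost operations on huge numbers, the usual objection to the uniform
  cost measure, cannot be exploited.
\<close>

type_synonym state = "(nat \<Rightarrow> nat) \<times> (nat \<Rightarrow> nat)"  \<comment> \<open>registers, memory\<close>

datatype com =
    Const nat nat
  | Copy nat nat
  | Inc nat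
  | Dec nat
  | Load nat nat
  | Store nat nat
  | Seq com com
  | IfLess nat nat com com
  | WhileLess nat nat com

text \<open>\<open>exec p s t s'\<close>: program \<open>p\<close> started in \<open>s\<close> halts in \<open>s'\<close> after exactly \<open>t\<close> steps.
  Every primitive command and every evaluation of a test takes one step.\<close>

inductive exec :: "com \<Rightarrow> state \<Rightarrow> nat \<Rightarrow> state \<Rightarrow> bool" where
  "exec (Const x c) (R, M) 1 (R(x := c), M)"
| "exec (Copy x y) (R, M) 1 (R(x := R y), M)"
| "exec (Inc x) (R, M) 1 (R(x := R x + 1), M)"
| "exec (Dec x) (R, M) 1 (R(x := R x - 1), M)"
| "exec (Load x y) (R, M) 1 (R(x := M (R y)), M)"
| "exec (Store x y) (R, M) 1 (R, M(R x := R y))"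
| "exec p s t s' \<Longrightarrow> exec q s' t' s'' \<Longrightarrow> exec (Seq p q) s (t + t') s''"
| "R x < R y \<Longrightarrow> exec p (R, M) t s' \<Longrightarrow> exec (IfLess x y p q) (R, M) (t + 1) s'"
| "\<not> R x < R y \<Longrightarrow> exec q (R, M) t s' \<Longrightarrow> exec (IfLess x y p q) (R, M) (t + 1) s'"
| "\<not> R x < R y \<Longrightarrow> exec (WhileLess x y p) (R, M) 1 (R, M)"
| "R x < R y \<Longrightarrow> exec p (R, M) t s' \<Longrightarrow> exec (WhileLess x y p) s' t' s'' \<Longrightarrow>
     exec (WhileLess x y p) (R, M) (t + t' + 1) s''"

lemma exec_deterministic:
  assumes "exec p s t s'" "exec p s u s''"
  shows "t = u \<and> s' = s''"
  using assms
proof (induction arbitrary: u s'' rule: exec.induct)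
  case (7 p s t s' q t' s2)
  from "7.prems" show ?case by (cases rule: exec.cases) (use "7.IH" in \<open>fastforce+\<close>)
next
  case (8 R x y p M t s' q)
  from "8.prems" show ?case by (cases rule: exec.cases) (use 8 in \<open>fastforce+\<close>)
next
  case (9 R x y q M t s' p)
  from "9.prems" show ?case by (cases rule: exec.cases) (use 9 in \<open>fastforce+\<close>)
next
  case (10 R x y p M)
  from "10.prems" show ?case by (cases rule: exec.cases) (use 10 in \<open>fastforce+\<close>)
next
  case (11 R x y p M t s' t' s2)
  from "11.prems" show ?case by (cases rule: exec.cases) (use "11.IH" "11.hyps" in \<open>fastforce+\<close>)
qed (erule exec.cases; simp)+

text \<open>
  Input: a graph with vertices \<open>0, \<dots>, n - 1\<close>, given by \<open>n\<close> (register 0), the parameter \<open>k\<close>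
  (register 1) and the adjacency matrix, stored row by row in the memory. Everything else is 0.
\<close>

definition input_state :: "ugraph \<Rightarrow> nat \<Rightarrow> nat \<Rightarrow> state" where
  "input_state G n k =
     ((\<lambda>_. 0)(0 := n, 1 := k),
      (\<lambda>a. if a < n * n \<and> (a div n, a mod n) \<in> parcs G then 1 else 0))"

definition accepting :: "state \<Rightarrow> bool" where
  "accepting s \<longleftrightarrow> fst s 0 \<noteq> 0"

definition decides_in_time ::
    "com \<Rightarrow> (ugraph \<Rightarrow> nat \<Rightarrow> bool) \<Rightarrow> (nat \<Rightarrow> nat \<Rightarrow> nat) \<Rightarrow> bool" where
  "decides_in_time p Q T \<longleftrightarrow>
     (\<forall>G n k. pair_graph G \<and> pverts G = {..<n} \<longrightarrow>
        (\<exists>t s. exec p (input_state G n k) t s \<and> t \<le> T n k \<and> (accepting s \<longleftrightarrow> Q G k)))"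

end

(*
A component is bad if it contains a copy of a member of F1 and a copy of a member of F2. Take two such
copies at minimum distance. A shortest path between them is induced, so if it had alpha vertices, its
last alpha vertices would form a copy of a member of F1 that meets the second copy, at distance 0.
Hence the two copies and the path together form a connected set of at most c = d1 + d2 + alpha - 2
vertices, and the problem is to hit all connected sets of at most c vertices that contain copies from
both families. Some vertex of each such set has to be deleted, which gives a search tree of depth k and
degree c. The program runs through its c^k leaves: for each digit string of length k in base c it
repeats k times the search for the first bad c-tuple (repetitions allowed) of unmarked vertices, and
marks the entry of the tuple selected by the next digit.
*)
theory Submission
  imports Defs
begin

section \<open>Connected sets and copies of forbidden graphs\<close>

text \<open>The machine has neither recursion nor a stack, so the search tree is not traversed: a
  leaf is a number below \<open>c ^ k\<close>, and its branch is replayed from an empty set of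
  marks, which costs only a polynomial factor. Testing a tuple needs no graph algorithm at run time
  either. As the families are fixed, the verdict is a Boolean function of a constant number of
  adjacencies and equalities, and it is tabulated in the program text. The scan of all
  \<open>n ^ c\<close> tuples is polynomial because \<open>c\<close> is fixed too. This dictates the
  form of the graph-theoretic half: everything is reduced to an edge relation and sets or tuples of
  vertices, where deleting \<open>S\<close> only means that tuples must avoid
  \<open>S\<close>.\<close>

definition conn :: "(nat \<times> nat) set \<Rightarrow> nat set \<Rightarrow> bool" where
  "conn E X \<longleftrightarrow> X \<noteq> {} \<and> (\<forall>u\<in>X. \<forall>v\<in>X. (u, v) \<in> (E \<inter> X \<times> X)\<^sup>*)"

definition induced :: "ugraph \<Rightarrow> nat set \<Rightarrow> ugraph" where
  "induced G X = \<lparr> pverts = X, parcs = parcs G \<inter> X \<times> X \<rparr>"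

text \<open>An edge relation and a target set take the place of the host graph, so that a copy can
  be confined to fewer vertices without forming an induced subgraph.\<close>

definition embeds :: "ugraph \<Rightarrow> (nat \<times> nat) set \<Rightarrow> nat set \<Rightarrow> (nat \<Rightarrow> nat) \<Rightarrow> bool" where
  "embeds H E X \<phi> \<longleftrightarrow> inj_on \<phi> (pverts H) \<and> \<phi> ` pverts H \<subseteq> X \<and>
     (\<forall>u\<in>pverts H. \<forall>v\<in>pverts H. (u, v) \<in> parcs H \<longleftrightarrow> (\<phi> u, \<phi> v) \<in> E)"

definition hits :: "ugraph set \<Rightarrow> (nat \<times> nat) set \<Rightarrow> nat set \<Rightarrow> bool" where
  "hits F E X \<longleftrightarrow> (\<exists>H\<in>F. \<exists>\<phi>. embeds H E X \<phi>)"

text \<open>Outside \<open>X\<close> the ordinary closure is still reflexive while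
  \<open>rtrancl_on\<close> is not, hence the hypothesis on \<open>u\<close>.\<close>

lemma rtrancl_on_eq_rtrancl:
  assumes "u \<in> X"
  shows "(u, v) \<in> rtrancl_on X E \<longleftrightarrow> (u, v) \<in> (E \<inter> X \<times> X)\<^sup>*"
proof
  assume "(u, v) \<in> rtrancl_on X E"
  then show "(u, v) \<in> (E \<inter> X \<times> X)\<^sup>*"
  proof (induction rule: rtrancl_on_induct)
    case (step y z)
    then have "(y, z) \<in> E \<inter> X \<times> X" by simp
    with step.IH show ?case by (rule rtrancl_into_rtrancl)
  qed simp
next
  assume "(u, v) \<in> (E \<inter> X \<times> X)\<^sup>*"
  then show "(u, v) \<in> rtrancl_on X E"
  proof (induction rule: rtrancl_induct)
    case (step y z)
    then have "(y, z) \<in> E" "z \<in> X" by auto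
    with step.IH show ?case by (rule rtrancl_on_into_rtrancl_on)
  qed (use assms in simp)
qed

lemma strongly_connected_iff_conn:
  "strongly_connected (with_proj C) \<longleftrightarrow> conn (parcs C) (pverts C)"
  by (simp add: strongly_connected_def conn_def reachable_def rtrancl_on_eq_rtrancl)

lemma pair_graph_arcs:
  assumes "pair_graph G"
  shows "finite (pverts G)" "parcs G \<subseteq> pverts G \<times> pverts G"
    "(u, v) \<in> parcs G \<Longrightarrow> (v, u) \<in> parcs G" "(u, u) \<notin> parcs G"
proof -
  interpret pair_graph G by fact
  show "finite (pverts G)" by (rule pair_finite_verts)
  show "parcs G \<subseteq> pverts G \<times> pverts G" using in_arcsD1 in_arcsD2 by auto
  show "(u, v) \<in> parcs G \<Longrightarrow> (v, u) \<in> parcs G" using graph_symmetric by simp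
  show "(u, u) \<notin> parcs G" using pair_no_loops by fastforce
qed

lemma pair_graphI:
  assumes "finite (pverts G)" "parcs G \<subseteq> pverts G \<times> pverts G"
    "\<And>u v. (u, v) \<in> parcs G \<Longrightarrow> (v, u) \<in> parcs G" "\<And>u. (u, u) \<notin> parcs G"
  shows "pair_graph G"
proof
  show "finite (parcs G)" using assms(1,2) finite_subset by blast
  show "symmetric (with_proj G)" using assms(3) by (auto simp: symmetric_def sym_def)
  show "fst e \<noteq> snd e" if "e \<in> parcs G" for e using that assms(4) by (cases e) auto
qed (use assms in auto)

lemma pair_graph_induced:
  assumes "pair_graph G" "X \<subseteq> pverts G"
  shows "pair_graph (induced G X)"
  using pair_graph_arcs[OF assms(1)] assms(2)
  by (intro pair_graphI) (auto simp: induced_def intro: finite_subset)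

text \<open>The notion \<open>connected\<close> asks for strong connectivity of the symmetric
  closure, and a \<open>pair_graph\<close> is its own symmetric closure.\<close>

lemma connected_iff_conn:
  assumes "pair_graph H"
  shows "connected (with_proj H) \<longleftrightarrow> conn (parcs H) (pverts H)"
proof -
  have "parcs (mk_symmetric (with_proj H)) = parcs H"
    using pair_graph_arcs(3)[OF assms] by (auto simp: mk_symmetric_def)
  moreover have "pverts (mk_symmetric (with_proj H)) = pverts H"
    by (simp add: mk_symmetric_def)
  ultimately show ?thesis
    by (simp add: connected_def strongly_connected_iff_conn)
qed

lemma induced_subgraph_iff:
  fixes G K :: ugraph
  assumes "pair_graph G"
  shows "induced_subgraph (with_proj K) (with_proj G) \<longleftrightarrow>
    pverts K \<subseteq> pverts G \<and> parcs K = parcs G \<inter> pverts K \<times> pverts K" (is "?L \<longleftrightarrow> ?R")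
proof
  assume ?L
  then have "pverts K \<subseteq> pverts G" "parcs K = {e \<in> parcs G. fst e \<in> pverts K \<and> snd e \<in> pverts K}"
    by (auto simp: induced_subgraph_def subgraph_def)
  then show ?R by auto
next
  assume R: ?R
  have "pair_graph (induced G (pverts K))" using R pair_graph_induced[OF assms] by simp
  moreover have "induced G (pverts K) = K" using R by (simp add: induced_def)
  ultimately have "pair_graph K" by simp
  then have "wf_digraph (with_proj G)" "wf_digraph (with_proj K)"
    using assms unfolding wf_digraph_wp_iff
    by (auto simp: pair_graph_def pair_digraph_def pair_fin_digraph_def)
  moreover have "parcs K = {e \<in> parcs G. fst e \<in> pverts K \<and> snd e \<in> pverts K}"
    using R by auto
  ultimately show ?L
    using R by (auto simp: induced_subgraph_def subgraph_def)
qed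

section \<open>Components as maximal connected vertex sets\<close>

lemma conn_induced [simp]: "conn (parcs (induced G X)) X \<longleftrightarrow> conn (parcs G) X"
  by (simp add: conn_def induced_def inf_assoc)

lemma pverts_induced [simp]: "pverts (induced G X) = X"
  by (simp add: induced_def)

lemma components_iff:
  assumes "pair_graph G"
  shows "C \<in> components G \<longleftrightarrow> (\<exists>X \<subseteq> pverts G. C = induced G X \<and> conn (parcs G) X \<and>
    (\<forall>Y \<subseteq> pverts G. conn (parcs G) Y \<longrightarrow> \<not> X \<subset> Y))"
proof -
  have *: "induced_subgraph (with_proj K) (with_proj G) \<and> strongly_connected (with_proj K) \<longleftrightarrow>
     pverts K \<subseteq> pverts G \<and> K = induced G (pverts K) \<and> conn (parcs G) (pverts K)" for K
    unfolding induced_subgraph_iff[OF assms] strongly_connected_iff_conn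
    by (cases K) (auto simp: induced_def conn_def inf_assoc)
  have **: "(\<exists>H'. induced_subgraph H' (with_proj G) \<and> strongly_connected H' \<and> X \<subset> verts H') \<longleftrightarrow>
     (\<exists>Y \<subseteq> pverts G. conn (parcs G) Y \<and> X \<subset> Y)" for X
  proof
    assume "\<exists>H'. induced_subgraph H' (with_proj G) \<and> strongly_connected H' \<and> X \<subset> verts H'"
    then obtain H' where H': "induced_subgraph H' (with_proj G)" "strongly_connected H'" "X \<subset> verts H'"
      by blast
    \<comment> \<open>The competitor \<open>H'\<close> ranges over arbitrary digraph records;
      compatibility with \<open>G\<close> forces its tail and head to be the projections, so it
      comes from a pair record as well.\<close>
    then have "H' = with_proj \<lparr> pverts = verts H', parcs = arcs H' \<rparr>"
      by (auto simp: induced_subgraph_def subgraph_def compatible_def with_proj_def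
          intro: pre_digraph.equality)
    with H' *[of "\<lparr> pverts = verts H', parcs = arcs H' \<rparr>"]
    show "\<exists>Y \<subseteq> pverts G. conn (parcs G) Y \<and> X \<subset> Y" by auto
  next
    assume "\<exists>Y \<subseteq> pverts G. conn (parcs G) Y \<and> X \<subset> Y"
    then obtain Y where "Y \<subseteq> pverts G" "conn (parcs G) Y" "X \<subset> Y" by blast
    then show "\<exists>H'. induced_subgraph H' (with_proj G) \<and> strongly_connected H' \<and> X \<subset> verts H'"
      using *[of "induced G Y"] by (intro exI[of _ "with_proj (induced G Y)"]) simp
  qed
  have 3: "C \<in> components G \<longleftrightarrow> (pverts C \<subseteq> pverts G \<and> C = induced G (pverts C) \<and>
     conn (parcs G) (pverts C)) \<and> \<not> (\<exists>Y \<subseteq> pverts G. conn (parcs G) Y \<and> pverts C \<subset> Y)"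
    unfolding components_def pre_digraph.sccs_def mem_Collect_eq **[symmetric] *[symmetric]
    by simp
  show ?thesis unfolding 3 by (auto simp: induced_def) blast
qed

lemma components_conn:
  assumes "pair_graph G" "X \<subseteq> pverts G" "conn (parcs G) X"
  shows "components (induced G X) = {induced G X}"
proof -
  have "induced (induced G X) Y = induced G Y" if "Y \<subseteq> X" for Y
    using that by (auto simp: induced_def)
  moreover have "Y = X" if "Y \<subseteq> X" "\<And>Z. Z \<subseteq> X \<Longrightarrow> conn (parcs (induced G X)) Z \<Longrightarrow> \<not> Y \<subset> Z" for Y
    using that(1) that(2)[of X] assms(3) by auto
  ultimately show ?thesis
    using components_iff[OF pair_graph_induced[OF assms(1,2)]] assms(3)
    by (intro set_eqI) (auto 4 4)
qed

lemma ex_component: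
  assumes "pair_graph G" "X \<subseteq> pverts G" "conn (parcs G) X"
  obtains Y where "X \<subseteq> Y" "Y \<subseteq> pverts G" "conn (parcs G) Y" "induced G Y \<in> components G"
proof -
  let ?A = "{Y. X \<subseteq> Y \<and> Y \<subseteq> pverts G \<and> conn (parcs G) Y}"
  have fin: "finite ?A"
    by (rule finite_subset[of _ "Pow (pverts G)"]) (use pair_graph_arcs(1)[OF assms(1)] in auto)
  have "X \<in> ?A" using assms by simp
  from finite_has_maximal2[OF fin this]
  obtain Y where Y: "Y \<in> ?A" "\<forall>Z\<in>?A. Y \<subseteq> Z \<longrightarrow> Y = Z" by (elim bexE conjE)
  have "induced G Y \<in> components G"
    unfolding components_iff[OF assms(1)] using Y by (intro exI[of _ Y]) (simp, blast)
  with Y show ?thesis by (intro that[of Y]) auto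
qed

section \<open>Isomorphisms and induced copies\<close>

lemma isomorphic_ex_map:
  assumes "isomorphic H K"
  shows "\<exists>\<phi>. bij_betw \<phi> (pverts H) (pverts K) \<and>
     (\<forall>u\<in>pverts H. \<forall>v\<in>pverts H. (u, v) \<in> parcs H \<longleftrightarrow> (\<phi> u, \<phi> v) \<in> parcs K)"
proof -
  obtain f where f: "pre_digraph.digraph_isomorphism (with_proj H) f"
      "with_proj K = app_iso f (with_proj H)"
    using assms by (auto simp: digraph_iso_def)
  have tl: "iso_tail f = fst" "iso_head f = snd"
    using arg_cong[OF f(2), of tail] arg_cong[OF f(2), of head] by auto
  have vs: "pverts K = iso_verts f ` pverts H" "parcs K = iso_arcs f ` parcs H"
    using arg_cong[OF f(2), of verts] arg_cong[OF f(2), of arcs] by auto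
  note d = f(1)[unfolded pre_digraph.digraph_isomorphism_def with_proj_simps]
  \<comment> \<open>An isomorphism carries separate maps for vertices and arcs; since tail and head
    are projections on both sides, the vertex map determines the arc map.\<close>
  have "iso_arcs f a = (\<lambda>(u, v). (iso_verts f u, iso_verts f v)) a" if "a \<in> parcs H" for a
  proof -
    have "iso_verts f (fst a) = fst (iso_arcs f a)" "iso_verts f (snd a) = snd (iso_arcs f a)"
      using d that tl by auto
    then show ?thesis by (simp add: case_prod_beta)
  qed
  then have arcs: "parcs K = (\<lambda>(u, v). (iso_verts f u, iso_verts f v)) ` parcs H"
    unfolding vs(2) by (rule image_cong[OF refl])
  have sub: "parcs H \<subseteq> pverts H \<times> pverts H"
    using d wf_digraph.head_in_verts[of "with_proj H"] wf_digraph.tail_in_verts[of "with_proj H"]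
    by (auto simp: mem_Times_iff)
  have "(u, v) \<in> parcs H \<longleftrightarrow> (iso_verts f u, iso_verts f v) \<in> parcs K"
    if uv: "u \<in> pverts H" "v \<in> pverts H" for u v
  proof -
    have "u = a \<and> v = b" if "(a, b) \<in> parcs H" "iso_verts f u = iso_verts f a" "iso_verts f v = iso_verts f b" for a b
      using that uv sub d unfolding inj_on_def by blast
    then show ?thesis unfolding arcs by auto
  qed
  moreover have "bij_betw (iso_verts f) (pverts H) (pverts K)"
    using d vs(1) by (auto simp: bij_betw_def)
  ultimately show ?thesis by blast
qed

lemma contains_induced_iff_embeds:
  assumes "pair_graph G" "pair_graph H"
  shows "contains_induced G H \<longleftrightarrow> (\<exists>\<phi>. embeds H (parcs G) (pverts G) \<phi>)"
proof
  assume "contains_induced G H"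
  then obtain K where K: "pverts K \<subseteq> pverts G" "parcs K = parcs G \<inter> pverts K \<times> pverts K"
      "isomorphic H K"
    using induced_subgraph_iff[OF assms(1)] by (auto simp: contains_induced_def)
  then obtain \<phi> where \<phi>: "bij_betw \<phi> (pverts H) (pverts K)"
     "\<forall>u\<in>pverts H. \<forall>v\<in>pverts H. (u, v) \<in> parcs H \<longleftrightarrow> (\<phi> u, \<phi> v) \<in> parcs K"
    using isomorphic_ex_map by blast
  have "(u, v) \<in> parcs H \<longleftrightarrow> (\<phi> u, \<phi> v) \<in> parcs G" if uv: "u \<in> pverts H" "v \<in> pverts H" for u v
    using \<phi> uv unfolding K(2) by (auto simp: bij_betw_def)
  then have "embeds H (parcs G) (pverts G) \<phi>"
    using \<phi>(1) K(1) by (auto simp: embeds_def bij_betw_def)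
  then show "\<exists>\<phi>. embeds H (parcs G) (pverts G) \<phi>" by blast
next
  assume "\<exists>\<phi>. embeds H (parcs G) (pverts G) \<phi>"
  then obtain \<phi> where \<phi>: "embeds H (parcs G) (pverts G) \<phi>" by blast
  interpret H: pair_graph H by fact
  let ?f = "\<lparr> iso_verts = \<phi>, iso_arcs = \<lambda>(u, v). (\<phi> u, \<phi> v), iso_head = snd, iso_tail = fst \<rparr>"
  let ?K = "induced G (\<phi> ` pverts H)"
  have sub: "parcs H \<subseteq> pverts H \<times> pverts H" using pair_graph_arcs[OF assms(2)] by simp
  have "inj_on (\<lambda>(u, v). (\<phi> u, \<phi> v)) (parcs H)"
  proof (rule inj_onI, clarify)
    fix a b c d assume "(a, b) \<in> parcs H" "(c, d) \<in> parcs H" "\<phi> a = \<phi> c" "\<phi> b = \<phi> d"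
    then show "a = c \<and> b = d" using \<phi> sub unfolding embeds_def inj_on_def by blast
  qed
  then have "pre_digraph.digraph_isomorphism (with_proj H) ?f"
    using \<phi> H.wf_digraph_axioms
    by (auto simp: pre_digraph.digraph_isomorphism_def embeds_def)
  moreover have "parcs ?K = (\<lambda>(u, v). (\<phi> u, \<phi> v)) ` parcs H"
  proof (intro set_eqI iffI)
    fix e assume "e \<in> parcs ?K"
    then obtain u v where "u \<in> pverts H" "v \<in> pverts H" "e = (\<phi> u, \<phi> v)" "e \<in> parcs G"
      by (auto simp: induced_def)
    then show "e \<in> (\<lambda>(u, v). (\<phi> u, \<phi> v)) ` parcs H"
      using \<phi> by (auto simp: embeds_def intro!: image_eqI[of _ _ "(u, v)"])
  next
    fix e assume "e \<in> (\<lambda>(u, v). (\<phi> u, \<phi> v)) ` parcs H"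
    then obtain u v where "(u, v) \<in> parcs H" "e = (\<phi> u, \<phi> v)" by auto
    then show "e \<in> parcs ?K"
      using \<phi> sub by (auto simp: embeds_def induced_def)
  qed
  then have "with_proj ?K = app_iso ?f (with_proj H)"
    by (simp add: app_iso_def with_proj_def)
  ultimately have "isomorphic H ?K" by (auto simp: digraph_iso_def)
  moreover have "induced_subgraph (with_proj ?K) (with_proj G)"
    using \<phi> induced_subgraph_iff[OF assms(1)] by (simp add: embeds_def induced_def)
  ultimately show "contains_induced G H" by (auto simp: contains_induced_def)
qed

lemma embeds_induced [simp]: "embeds H (parcs (induced G X)) X \<phi> \<longleftrightarrow> embeds H (parcs G) X \<phi>"
  by (auto simp: embeds_def induced_def image_subset_iff)

text \<open>A forbidden family only describes the graphs all of whose components lie in the class. A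
  connected graph is its own single component, so for it this becomes a membership test.\<close>

lemma conn_in_class_iff:
  assumes "forbidden_family \<P> F" "pair_graph G" "X \<subseteq> pverts G" "conn (parcs G) X"
  shows "induced G X \<in> \<P> \<longleftrightarrow> \<not> hits F (parcs G) X"
proof -
  have pg: "pair_graph (induced G X)" using assms pair_graph_induced by blast
  have "induced G X \<in> \<P> \<longleftrightarrow> \<not> (\<exists>H\<in>F. contains_induced (induced G X) H)"
    using assms(1) pg components_conn[OF assms(2-4)] unfolding forbidden_family_def
    by (metis singletonD singletonI)
  also have "\<dots> \<longleftrightarrow> \<not> hits F (parcs G) X"
    using assms(1) contains_induced_iff_embeds[OF pg]
    by (auto simp: hits_def forbidden_family_def)
  finally show ?thesis .
qed

lemma embeds_mono: "embeds H E X \<phi> \<Longrightarrow> X \<subseteq> Y \<Longrightarrow> embeds H E Y \<phi>"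
  by (auto simp: embeds_def)

lemma hits_mono: "hits F E X \<Longrightarrow> X \<subseteq> Y \<Longrightarrow> hits F E Y"
  by (meson hits_def embeds_mono)

text \<open>A component outside both classes is itself such a set \<open>X\<close>; conversely,
  containing a copy is monotone, so the component around \<open>X\<close> lies outside both classes.
  Admitting all connected sets, not only components, is what allows the passage to small
  ones.\<close>

lemma components_in_classes_iff:
  assumes "forbidden_family \<P>1 F1" "forbidden_family \<P>2 F2" "pair_graph G"
  shows "(\<forall>C\<in>components G. C \<in> \<P>1 \<or> C \<in> \<P>2) \<longleftrightarrow>
    \<not> (\<exists>X \<subseteq> pverts G. conn (parcs G) X \<and> hits F1 (parcs G) X \<and> hits F2 (parcs G) X)"
    (is "?L \<longleftrightarrow> ?R")
proof
  assume L: ?L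
  show ?R
  proof
    assume "\<exists>X \<subseteq> pverts G. conn (parcs G) X \<and> hits F1 (parcs G) X \<and> hits F2 (parcs G) X"
    then obtain X where X: "X \<subseteq> pverts G" "conn (parcs G) X" "hits F1 (parcs G) X" "hits F2 (parcs G) X"
      by blast
    then obtain Y where Y: "X \<subseteq> Y" "Y \<subseteq> pverts G" "conn (parcs G) Y" "induced G Y \<in> components G"
      using ex_component[OF assms(3)] by blast
    then have "hits F1 (parcs G) Y" "hits F2 (parcs G) Y" using X hits_mono by blast+
    then show False
      using Y L conn_in_class_iff[OF assms(1,3)] conn_in_class_iff[OF assms(2,3)] by blast
  qed
next
  assume ?R
  then show ?L
    using conn_in_class_iff[OF assms(1,3)] conn_in_class_iff[OF assms(2,3)]
    by (intro ballI) (auto simp: components_iff[OF assms(3)])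
qed

section \<open>Small connected sets that contain copies from both families\<close>

text \<open>Steps need to be preserved in one direction only and \<open>f\<close> need not be
  injective, so this serves for copies as well as for tuples with repeated entries.\<close>

lemma conn_image:
  assumes "conn R Z" "\<And>a b. (a, b) \<in> R \<Longrightarrow> a \<in> Z \<Longrightarrow> b \<in> Z \<Longrightarrow> (f a, f b) \<in> E"
  shows "conn E (f ` Z)"
proof -
  have "(f a, f b) \<in> (E \<inter> f ` Z \<times> f ` Z)\<^sup>*" if "(a, b) \<in> (R \<inter> Z \<times> Z)\<^sup>*" for a b
    using that
  proof (induction rule: rtrancl_induct)
    case (step y z)
    then have "(f y, f z) \<in> E \<inter> f ` Z \<times> f ` Z" using assms(2) by auto
    with step.IH show ?case by (rule rtrancl_into_rtrancl)
  qed simp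
  then show ?thesis using assms(1) by (auto simp: conn_def)
qed

lemma conn_embeds:
  assumes "conn (parcs H) (pverts H)" "embeds H E X \<phi>"
  shows "conn E (\<phi> ` pverts H)"
  using assms(1) by (rule conn_image) (use assms(2) in \<open>auto simp: embeds_def\<close>)

lemma conn_Un:
  assumes "conn E A" "conn E B" "A \<inter> B \<noteq> {}"
  shows "conn E (A \<union> B)"
proof -
  let ?R = "E \<inter> (A \<union> B) \<times> (A \<union> B)"
  obtain x where x: "x \<in> A" "x \<in> B" using assms(3) by blast
  have "(E \<inter> A \<times> A)\<^sup>* \<subseteq> ?R\<^sup>*" "(E \<inter> B \<times> B)\<^sup>* \<subseteq> ?R\<^sup>*" by (intro rtrancl_mono; blast)+
  then have "(u, x) \<in> ?R\<^sup>*" "(x, u) \<in> ?R\<^sup>*" if "u \<in> A \<union> B" for u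
    using that x assms(1,2) unfolding conn_def by blast+
  then show ?thesis using x by (auto simp: conn_def intro: rtrancl_trans[of _ x])
qed

lemma conn_path:
  assumes "\<And>a b. (a, b) \<in> E \<Longrightarrow> (b, a) \<in> E" "\<forall>i<l. (p i, p (Suc i)) \<in> E"
  shows "conn E (p ` {..l::nat})"
  using assms(2)
proof (induction l)
  case 0
  then show ?case by (simp add: conn_def)
next
  case (Suc l)
  have "conn E {p l, p (Suc l)}"
    using Suc.prems assms(1)[of "p l" "p (Suc l)"] by (auto simp: conn_def intro!: r_into_rtrancl)
  moreover have "conn E (p ` {..l})" using Suc by simp
  ultimately have "conn E (p ` {..l} \<union> {p l, p (Suc l)})" by (intro conn_Un) auto
  moreover have "p ` {..l} \<union> {p l, p (Suc l)} = p ` {..Suc l}" by (auto simp: atMost_Suc)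
  ultimately show ?case by simp
qed

text \<open>\<open>F1\<close> contains the path only up to isomorphism; a copy of
  \<open>path_graph\<close> has to become a copy of the actual member on the same vertices.\<close>

lemma embeds_isomorphic:
  assumes "isomorphic H K" "embeds K E X \<psi>"
  obtains \<phi> where "embeds H E X \<phi>" "\<phi> ` pverts H = \<psi> ` pverts K"
proof -
  obtain \<phi> where \<phi>: "bij_betw \<phi> (pverts H) (pverts K)"
      "\<forall>u\<in>pverts H. \<forall>v\<in>pverts H. (u, v) \<in> parcs H \<longleftrightarrow> (\<phi> u, \<phi> v) \<in> parcs K"
    using isomorphic_ex_map[OF assms(1)] by blast
  have im: "\<phi> ` pverts H = pverts K" using \<phi>(1) by (simp add: bij_betw_def)
  have "inj_on (\<psi> \<circ> \<phi>) (pverts H)"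
    using \<phi>(1) assms(2) im by (intro comp_inj_on) (auto simp: bij_betw_def embeds_def)
  moreover have "(\<psi> \<circ> \<phi>) ` pverts H = \<psi> ` pverts K" by (metis im image_comp)
  moreover have "(u, v) \<in> parcs H \<longleftrightarrow> ((\<psi> \<circ> \<phi>) u, (\<psi> \<circ> \<phi>) v) \<in> E"
    if "u \<in> pverts H" "v \<in> pverts H" for u v
  proof -
    have "\<phi> u \<in> pverts K" "\<phi> v \<in> pverts K" using that im by auto
    then show ?thesis using that \<phi>(2) assms(2) by (simp add: embeds_def)
  qed
  ultimately show ?thesis using assms(2) by (intro that[of "\<psi> \<circ> \<phi>"]) (auto simp: embeds_def)
qed

text \<open>The assumptions \<open>short\<close> are what minimal length provides: no vertex recurs
  and no chord skips ahead. Ascending index pairs suffice because \<open>E\<close> is symmetric and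
  irreflexive.\<close>

lemma embeds_shortest_path:
  assumes sym: "\<And>a b. (a, b) \<in> E \<Longrightarrow> (b, a) \<in> E" and irr: "\<And>a. (a, a) \<notin> E"
    and path: "\<And>i. i < m \<Longrightarrow> p i \<in> X" "\<And>i. Suc i < m \<Longrightarrow> (p i, p (Suc i)) \<in> E"
    and short: "\<And>i j. i < j \<Longrightarrow> j < m \<Longrightarrow> p i \<noteq> p j"
       "\<And>i j. i < j \<Longrightarrow> j < m \<Longrightarrow> (p i, p j) \<in> E \<Longrightarrow> j = Suc i"
  shows "embeds (path_graph m) E X p"
proof -
  have "inj_on p {..<m}"
    using short(1) by (auto simp: inj_on_def) (metis nat_neq_iff)
  moreover have "(p i, p j) \<in> E \<longleftrightarrow> j = Suc i \<or> i = Suc j" if "i < m" "j < m" for i j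
  proof
    assume "(p i, p j) \<in> E"
    then show "j = Suc i \<or> i = Suc j"
      using that short(2)[of i j] short(2)[of j i] sym[of "p i" "p j"] irr[of "p i"]
      by (cases i j rule: linorder_cases) auto
  qed (use path(2)[of i] path(2)[of j] sym that in auto)
  ultimately show ?thesis
    using path(1) by (auto simp: embeds_def path_graph_def)
qed

lemma small_witness:
  assumes sym: "\<And>a b. (a, b) \<in> E \<Longrightarrow> (b, a) \<in> E" and irr: "\<And>a. (a, a) \<notin> E"
    and F1: "\<And>H. H \<in> F1 \<Longrightarrow> finite (pverts H) \<and> card (pverts H) \<le> d1 \<and> conn (parcs H) (pverts H)"
    and F2: "\<And>H. H \<in> F2 \<Longrightarrow> finite (pverts H) \<and> card (pverts H) \<le> d2 \<and> conn (parcs H) (pverts H)"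
    and P: "P \<in> F1" "isomorphic P (path_graph \<alpha>)"
    and X: "conn E X" "hits F1 E X" "hits F2 E X"
  shows "\<exists>Y\<subseteq>X. conn E Y \<and> hits F1 E Y \<and> hits F2 E Y \<and> finite Y \<and> card Y \<le> d1 + d2 + \<alpha> - 2"
proof -
  let ?R = "E \<inter> X \<times> X"
  define copy where "copy F A \<longleftrightarrow> (\<exists>H\<in>F. \<exists>\<phi>. embeds H E X \<phi> \<and> A = \<phi> ` pverts H)" for F A
  \<comment> \<open>Walks are taken in \<open>E\<close> restricted to \<open>X\<close>, so that a
    copy formed by path vertices stays inside \<open>X\<close>. The least \<open>l\<close> is
    minimal over all pairs of copies and all choices of endpoints.\<close>
  define Q where "Q l \<longleftrightarrow> (\<exists>A B a b. copy F1 A \<and> copy F2 B \<and> a \<in> A \<and> b \<in> B \<and> (a, b) \<in> ?R ^^ l)" for l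
  have copy: "conn E A \<and> A \<subseteq> X \<and> finite A \<and> card A \<le> d \<and> hits F E A"
    if fam: "\<And>H. H \<in> F \<Longrightarrow> finite (pverts H) \<and> card (pverts H) \<le> d \<and> conn (parcs H) (pverts H)"
      and "copy F A"
    for F d A
  proof -
    obtain H \<phi> where H: "H \<in> F" "embeds H E X \<phi>" "A = \<phi> ` pverts H"
      using \<open>copy F A\<close> by (auto simp: copy_def)
    note h = fam[OF H(1)]
    have "card A \<le> d" using card_image_le[of "pverts H" \<phi>] h H(3) by simp
    moreover have "embeds H E A \<phi>" "A \<subseteq> X" using H by (auto simp: embeds_def)
    ultimately show ?thesis using conn_embeds[of H E X \<phi>] H h by (auto simp: hits_def)
  qed
  have copy1: "conn E A \<and> A \<subseteq> X \<and> finite A \<and> card A \<le> d1 \<and> hits F1 E A" if "copy F1 A" for A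
    using F1 that by (rule copy)
  have copy2: "conn E A \<and> A \<subseteq> X \<and> finite A \<and> card A \<le> d2 \<and> hits F2 E A" if "copy F2 A" for A
    using F2 that by (rule copy)
  obtain A0 B0 where "copy F1 A0" "copy F2 B0" using X(2,3) unfolding hits_def copy_def by blast
  then obtain a0 b0 where "a0 \<in> A0" "b0 \<in> B0" "a0 \<in> X" "b0 \<in> X"
    using copy1[of A0] copy2[of B0] unfolding conn_def by blast
  then have "(a0, b0) \<in> ?R\<^sup>*" using X(1) by (simp add: conn_def)
  then obtain l0 where "(a0, b0) \<in> ?R ^^ l0" using rtrancl_imp_relpow by blast
  then have "\<exists>l. Q l"
    unfolding Q_def using \<open>copy F1 A0\<close> \<open>copy F2 B0\<close> \<open>a0 \<in> A0\<close> \<open>b0 \<in> B0\<close> by blast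
  define l where "l = (LEAST l. Q l)"
  have Ql: "Q l" and least: "\<And>m. Q m \<Longrightarrow> l \<le> m"
    unfolding l_def by (rule LeastI_ex[OF \<open>\<exists>l. Q l\<close>], rule Least_le)
  from Ql obtain A B p where A: "copy F1 A" "p 0 \<in> A" and B: "copy F2 B" "p l \<in> B"
    and p: "\<forall>i<l. (p i, p (Suc i)) \<in> ?R"
    unfolding Q_def relpow_fun_conv by blast
  have pX: "p i \<in> X" if "i \<le> l" for i
    using that p B copy2[OF B(1)] by (cases "i = l") auto
  have seg: "(p i, p j) \<in> ?R ^^ (j - i)" if "i \<le> j" "j \<le> l" for i j
    unfolding relpow_fun_conv using that p by (intro exI[of _ "\<lambda>t. p (i + t)"]) auto
  \<comment> \<open>Replacing the segment from \<open>p i\<close> to \<open>p j\<close> by another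
    walk keeps both ends in the two copies, so minimality of \<open>l\<close> applies. Below,
    \<open>m = 0\<close> rules out repeated vertices and \<open>m = 1\<close> rules out
    chords.\<close>
  have short: "j - i \<le> m" if "i \<le> j" "j \<le> l" "(p i, p j) \<in> ?R ^^ m" for i j m
  proof -
    have "(p 0, p l) \<in> ?R ^^ (i + m + (l - j))"
      using seg[of 0 i] seg[of j l] that unfolding relpow_add by auto
    then have "l \<le> i + m + (l - j)" using A B by (intro least) (auto simp: Q_def)
    then show ?thesis using that by linarith
  qed
  have \<alpha>: "l = 0 \<and> 0 < \<alpha> \<or> l + 2 \<le> \<alpha>"
  proof (rule ccontr)
    assume "\<not> ?thesis"
    \<comment> \<open>\<open>conn\<close> excludes the empty set, so the path in \<open>F1\<close>
      has a vertex.\<close>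
    moreover have "0 < \<alpha>"
    proof -
      obtain f where "bij_betw f (pverts P) {..<\<alpha>}"
        using isomorphic_ex_map[OF P(2)] by (auto simp: path_graph_def)
      then have "{..<\<alpha>} \<noteq> {}" using F1[OF P(1)] by (auto simp: conn_def bij_betw_def)
      then show ?thesis by (cases \<alpha>) auto
    qed
    ultimately have l: "0 < l" "\<alpha> \<le> Suc l" by auto
    \<comment> \<open>The path has \<open>l + 1\<close> vertices; its last \<alpha> vertices begin
      at index \<open>s\<close>.\<close>
    then obtain s where s: "Suc l = s + \<alpha>" by (metis add.commute le_Suc_ex)
    define q where "q i = p (s + i)" for i
    have "embeds (path_graph \<alpha>) E X q"
    proof (rule embeds_shortest_path[OF sym irr])
      fix i j assume ij: "i < j" "j < \<alpha>"
      show "q i \<noteq> q j"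
      proof
        assume "q i = q j"
        then have "s + j - (s + i) \<le> 0" using ij s by (intro short) (auto simp: q_def)
        then show False using ij by simp
      qed
      show "j = Suc i" if "(q i, q j) \<in> E"
      proof -
        have "(p (s + i), p (s + j)) \<in> ?R ^^ 1" using that pX ij s by (auto simp: q_def)
        then have "s + j - (s + i) \<le> 1" using ij s by (intro short) auto
        then show ?thesis using ij by simp
      qed
    next
      show "q i \<in> X" if "i < \<alpha>" for i using that s by (auto simp: q_def intro!: pX)
      show "(q i, q (Suc i)) \<in> E" if "Suc i < \<alpha>" for i using that s p by (auto simp: q_def)
    qed
    then obtain \<phi> where "embeds P E X \<phi>" "\<phi> ` pverts P = q ` {..<\<alpha>}"
      by (rule embeds_isomorphic[OF P(2)]) (auto simp: path_graph_def)
    then have "copy F1 (q ` {..<\<alpha>})" using P(1) unfolding copy_def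
      by (intro bexI[of _ P] exI[of _ \<phi>]) auto
    moreover have "p l = q (\<alpha> - 1)" using s \<open>0 < \<alpha>\<close> by (cases \<alpha>) (auto simp: q_def)
    then have "p l \<in> q ` {..<\<alpha>}" using \<open>0 < \<alpha>\<close> by auto
    \<comment> \<open>The vertex \<open>p l\<close> lies in the new copy and in \<open>B\<close>, so
      two copies are at distance zero, contrary to \<open>0 < l\<close>.\<close>
    moreover have "(p l, p l) \<in> ?R ^^ 0" by simp
    ultimately have "Q 0" using B unfolding Q_def by blast
    then show False using least[of 0] l by simp
  qed
  define Y where "Y = A \<union> p ` {..l} \<union> B"
  note A' = copy1[OF A(1)] and B' = copy2[OF B(1)]
  have "conn E (p ` {..l})" using p by (intro conn_path[OF sym]) auto
  then have "conn E (A \<union> p ` {..l})" using A A' by (rule_tac conn_Un) auto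
  then have "conn E Y" unfolding Y_def using B B' by (rule_tac conn_Un) auto
  moreover have "Y \<subseteq> X" using A' B' pX by (auto simp: Y_def)
  moreover have "hits F1 E Y" using A' by (auto simp: Y_def intro: hits_mono[of F1 E A])
  moreover have "hits F2 E Y" using B' by (auto simp: Y_def intro: hits_mono[of F2 E B])
  moreover have "finite Y" using A' B' by (simp add: Y_def)
  \<comment> \<open>For \<open>l = 0\<close> the copies share a vertex, which leaves at most
    \<open>d1 + d2 - 1\<close>, and \<open>0 < \<alpha>\<close> suffices. Otherwise the ends of the
    path are already counted in the copies and only its \<open>l - 1\<close> inner vertices are
    added.\<close>
  moreover have "card Y \<le> d1 + d2 + \<alpha> - 2"
  proof (cases "l = 0")
    case True
    then have "p 0 \<in> A \<inter> B" using A B by simp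
    then have "A \<inter> B \<noteq> {}" "finite (A \<inter> B)" using A' by auto
    then have "0 < card (A \<inter> B)" by (simp add: card_gt_0_iff)
    moreover have "Y = A \<union> B" using True A B by (auto simp: Y_def)
    then have "card Y = card (A \<union> B)" by simp
    moreover have "card A + card B = card (A \<union> B) + card (A \<inter> B)" using A' B' card_Un_Int by blast
    moreover have "0 < \<alpha>" "card A \<le> d1" "card B \<le> d2" using \<alpha> A' B' by auto
    ultimately show ?thesis by linarith
  next
    case False
    have "{..l} = insert 0 (insert l {1..<l})" using False by auto
    then have "Y = A \<union> B \<union> p ` {1..<l}" using A B by (auto simp: Y_def)
    then have "card Y \<le> card A + card B + card (p ` {1..<l})"
      by (metis card_Un_le add_le_mono1 order_trans)
    also have "card (p ` {1..<l}) \<le> l - 1" using card_image_le[of "{1..<l}" p] by simp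
    finally have "card Y \<le> card A + card B + (l - 1)" by simp
    moreover have "l + 2 \<le> \<alpha>" "card A \<le> d1" "card B \<le> d2" using \<alpha> A' B' False by auto
    ultimately show ?thesis by linarith
  qed
  ultimately show ?thesis by blast
qed


text \<open>
  Whether a \<open>c\<close>-tuple spans a bad set depends only on which entries are adjacent and which are equal.
  Tuples may repeat vertices, so that \<open>c\<close>-tuples represent all nonempty sets of at most \<open>c\<close> vertices.
\<close>

definition pattern_embeds ::
    "ugraph \<Rightarrow> nat \<Rightarrow> (nat \<Rightarrow> nat \<Rightarrow> bool) \<Rightarrow> (nat \<Rightarrow> nat \<Rightarrow> bool) \<Rightarrow> (nat \<Rightarrow> nat) \<Rightarrow> bool" where
  "pattern_embeds H c adj eq \<phi> \<longleftrightarrow> \<phi> ` pverts H \<subseteq> {..<c} \<and>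
     (\<forall>u\<in>pverts H. \<forall>v\<in>pverts H. (u = v \<longleftrightarrow> eq (\<phi> u) (\<phi> v)) \<and> ((u, v) \<in> parcs H \<longleftrightarrow> adj (\<phi> u) (\<phi> v)))"

text \<open>Positions that hold the same vertex are joined by no edge but must count as connected,
  hence the disjunct \<open>eq i j\<close>.\<close>

definition bad_pattern ::
    "ugraph set \<Rightarrow> ugraph set \<Rightarrow> nat \<Rightarrow> (nat \<Rightarrow> nat \<Rightarrow> bool) \<Rightarrow> (nat \<Rightarrow> nat \<Rightarrow> bool) \<Rightarrow> bool" where
  "bad_pattern F1 F2 c adj eq \<longleftrightarrow> conn {(i, j). adj i j \<or> eq i j} {..<c} \<and>
     (\<exists>H\<in>F1. \<exists>\<phi>. pattern_embeds H c adj eq \<phi>) \<and> (\<exists>H\<in>F2. \<exists>\<phi>. pattern_embeds H c adj eq \<phi>)"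

abbreviation tuple_pattern :: "ugraph set \<Rightarrow> ugraph set \<Rightarrow> nat \<Rightarrow> (nat \<times> nat) set \<Rightarrow> (nat \<Rightarrow> nat) \<Rightarrow> bool" where
  "tuple_pattern F1 F2 c E f \<equiv> bad_pattern F1 F2 c (\<lambda>i j. (f i, f j) \<in> E) (\<lambda>i j. f i = f j)"

text \<open>A copy among positions is pushed forward along \<open>f\<close>; a copy in
  \<open>X\<close> is pulled back along a right inverse of \<open>f\<close>. Comparing entries by
  \<open>eq\<close> takes the place of injectivity.\<close>

lemma pattern_embeds_iff:
  assumes "f ` {..<c} = X"
  shows "(\<exists>\<phi>. pattern_embeds H c (\<lambda>i j. (f i, f j) \<in> E) (\<lambda>i j. f i = f j) \<phi>) \<longleftrightarrow> (\<exists>\<psi>. embeds H E X \<psi>)"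
proof
  assume "\<exists>\<phi>. pattern_embeds H c (\<lambda>i j. (f i, f j) \<in> E) (\<lambda>i j. f i = f j) \<phi>"
  then obtain \<phi> where "pattern_embeds H c (\<lambda>i j. (f i, f j) \<in> E) (\<lambda>i j. f i = f j) \<phi>" by blast
  then have "embeds H E X (f \<circ> \<phi>)"
    using assms by (auto simp: pattern_embeds_def embeds_def inj_on_def)
  then show "\<exists>\<psi>. embeds H E X \<psi>" by blast
next
  assume "\<exists>\<psi>. embeds H E X \<psi>"
  then obtain \<psi> where \<psi>: "embeds H E X \<psi>" by blast
  define g where "g = inv_into {..<c} f"
  have g: "f (g x) = x" "g x \<in> {..<c}" if "x \<in> X" for x
    using that assms f_inv_into_f[of x f "{..<c}"] inv_into_into[of x f "{..<c}"] by (auto simp: g_def)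
  have "\<psi> u \<in> X" if "u \<in> pverts H" for u using that \<psi> by (auto simp: embeds_def)
  then have "pattern_embeds H c (\<lambda>i j. (f i, f j) \<in> E) (\<lambda>i j. f i = f j) (g \<circ> \<psi>)"
    using \<psi> g by (auto simp: pattern_embeds_def embeds_def inj_on_def)
  then show "\<exists>\<phi>. pattern_embeds H c (\<lambda>i j. (f i, f j) \<in> E) (\<lambda>i j. f i = f j) \<phi>" by blast
qed

lemma conn_pattern_iff:
  assumes f: "f ` {..<c} = X"
  shows "conn {(i, j). (f i, f j) \<in> E \<or> f i = f j} {..<c} \<longleftrightarrow> conn E X"
proof
  assume "conn {(i, j). (f i, f j) \<in> E \<or> f i = f j} {..<c}"
  then have "conn (E \<union> Id) X"
    unfolding f[symmetric] by (rule conn_image) auto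
  moreover have "(E \<inter> X \<times> X)\<^sup>* = ((E \<union> Id) \<inter> X \<times> X)\<^sup>*"
    by (rule rtrancl_subset[symmetric]) auto
  ultimately show "conn E X" by (simp add: conn_def)
next
  assume X: "conn E X"
  let ?R = "{(i, j). (f i, f j) \<in> E \<or> f i = f j}"
  define g where "g = inv_into {..<c} f"
  have g: "f (g x) = x" "g x \<in> {..<c}" if "x \<in> X" for x
    using that f f_inv_into_f[of x f "{..<c}"] inv_into_into[of x f "{..<c}"] by (auto simp: g_def)
  have sub: "g ` X \<subseteq> {..<c}" using g by auto
  have "conn ?R (g ` X)" using X by (rule conn_image) (use g in auto)
  then have 1: "(g x, g y) \<in> (?R \<inter> {..<c} \<times> {..<c})\<^sup>*" if "x \<in> X" "y \<in> X" for x y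
    using that rtrancl_mono[of "?R \<inter> g ` X \<times> g ` X" "?R \<inter> {..<c} \<times> {..<c}"] sub
    by (auto simp: conn_def)
  have "(i, j) \<in> (?R \<inter> {..<c} \<times> {..<c})\<^sup>*" if ij: "i \<in> {..<c}" "j \<in> {..<c}" for i j
  proof -
    have fX: "f i \<in> X" "f j \<in> X" using ij f by auto
    \<comment> \<open>Each position reaches the chosen representative \<open>g (f i)\<close> of its
      vertex by one equality step; the representatives are connected among themselves by
      edges.\<close>
    then have "(i, g (f i)) \<in> ?R \<inter> {..<c} \<times> {..<c}" "(g (f j), j) \<in> ?R \<inter> {..<c} \<times> {..<c}"
      using g ij by auto
    with 1[OF fX] show ?thesis by (meson converse_rtrancl_into_rtrancl rtrancl_into_rtrancl)
  qed
  moreover have "{..<c} \<noteq> {}" using X f by (auto simp: conn_def)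
  ultimately show "conn ?R {..<c}" by (auto simp: conn_def)
qed

lemma tuple_pattern_iff:
  "tuple_pattern F1 F2 c E f \<longleftrightarrow>
    conn E (f ` {..<c}) \<and> hits F1 E (f ` {..<c}) \<and> hits F2 E (f ` {..<c})"
  unfolding bad_pattern_def conn_pattern_iff[OF refl] pattern_embeds_iff[OF refl] hits_def ..

lemma ex_tuple_image:
  assumes "finite Y" "Y \<noteq> {}" "card Y \<le> c"
  shows "\<exists>f. f ` {..<c} = Y"
proof -
  obtain h where h: "bij_betw h {..<card Y} Y"
    using ex_bij_betw_nat_finite[OF assms(1)] by (auto simp: atLeast0LessThan)
  obtain y where y: "y \<in> Y" using assms(2) by blast
  \<comment> \<open>Surplus positions are filled with the fixed vertex \<open>y\<close>; this is
    where repeated entries are needed.\<close>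
  let ?f = "\<lambda>i. if i < card Y then h i else y"
  have hY: "h ` {..<card Y} = Y" using h by (simp add: bij_betw_def)
  have "Y \<subseteq> ?f ` {..<c}"
  proof
    fix x assume "x \<in> Y"
    then obtain i where "i < card Y" "x = h i" using hY by auto
    then show "x \<in> ?f ` {..<c}" using assms(3) by (intro image_eqI[of _ _ i]) auto
  qed
  moreover have "?f ` {..<c} \<subseteq> Y" using hY y by auto
  ultimately show ?thesis by blast
qed


section \<open>Deletion sets as hitting sets of bad tuples\<close>

lemma components_tuple_iff:
  assumes "forbidden_family \<P>1 F1" "forbidden_family \<P>2 F2"
    and "finite F1" "finite F2"
    and "\<forall>H \<in> F1 \<union> F2. connected (with_proj H)"
    and "\<exists>H \<in> F1. isomorphic H (path_graph \<alpha>)"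
    and "c = max_order F1 + max_order F2 + \<alpha> - 2"
    and "pair_graph G"
  shows "(\<forall>C\<in>components G. C \<in> \<P>1 \<or> C \<in> \<P>2) \<longleftrightarrow>
    \<not> (\<exists>f. f ` {..<c} \<subseteq> pverts G \<and> tuple_pattern F1 F2 c (parcs G) f)"
proof -
  have fam: "finite (pverts H) \<and> card (pverts H) \<le> max_order F \<and> conn (parcs H) (pverts H)"
    if "F = F1 \<or> F = F2" "H \<in> F" for F H
  proof -
    have "pair_graph H" using assms(1,2) that by (auto simp: forbidden_family_def)
    then have "finite (pverts H)" "conn (parcs H) (pverts H)"
      using pair_graph_arcs(1) connected_iff_conn[of H] assms(5) that by blast+
    moreover have "card (pverts H) \<le> max_order F"
      using assms(3,4) that unfolding max_order_def by (intro Max_ge) auto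
    ultimately show ?thesis by simp
  qed
  obtain P where P: "P \<in> F1" "isomorphic P (path_graph \<alpha>)" using assms(6) by blast
  have "(\<exists>X\<subseteq>pverts G. conn (parcs G) X \<and> hits F1 (parcs G) X \<and> hits F2 (parcs G) X) \<longleftrightarrow>
    (\<exists>f. f ` {..<c} \<subseteq> pverts G \<and> tuple_pattern F1 F2 c (parcs G) f)" (is "?L \<longleftrightarrow> ?R")
  proof
    assume ?L
    then obtain X where X: "X \<subseteq> pverts G" "conn (parcs G) X" "hits F1 (parcs G) X" "hits F2 (parcs G) X"
      by blast
    have "\<exists>Y\<subseteq>X. conn (parcs G) Y \<and> hits F1 (parcs G) Y \<and> hits F2 (parcs G) Y \<and>
        finite Y \<and> card Y \<le> max_order F1 + max_order F2 + \<alpha> - 2"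
      by (rule small_witness[OF pair_graph_arcs(3,4)[OF assms(8)] fam fam P X(2-4)]) auto
    then obtain Y where Y: "Y \<subseteq> X" "conn (parcs G) Y" "hits F1 (parcs G) Y" "hits F2 (parcs G) Y"
      "finite Y" "card Y \<le> c" using assms(7) by blast
    moreover have "Y \<noteq> {}" using Y by (simp add: conn_def)
    ultimately obtain f where "f ` {..<c} = Y" using ex_tuple_image by metis
    then show ?R using Y X(1) unfolding tuple_pattern_iff by (intro exI[of _ f]) simp
  next
    assume ?R
    then show ?L unfolding tuple_pattern_iff by blast
  qed
  then show ?thesis using components_in_classes_iff[OF assms(1,2,8)] by simp
qed

text \<open>For a tuple that avoids \<open>S\<close>, adjacency is the same in \<open>G\<close> and
  in \<open>G - S\<close>. The graph can therefore stay fixed while \<open>S\<close> only restricts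
  the range of the tuples, just as the program leaves the matrix alone and consults the
  marks.\<close>

lemma deletable_iff:
  assumes "forbidden_family \<P>1 F1" "forbidden_family \<P>2 F2"
    and "finite F1" "finite F2"
    and "\<forall>H \<in> F1 \<union> F2. connected (with_proj H)"
    and "\<exists>H \<in> F1. isomorphic H (path_graph \<alpha>)"
    and "c = max_order F1 + max_order F2 + \<alpha> - 2"
    and "pair_graph G"
  shows "deletable \<P>1 \<P>2 G k \<longleftrightarrow> (\<exists>S \<subseteq> pverts G. card S \<le> k \<and>
    \<not> (\<exists>f. f ` {..<c} \<subseteq> pverts G - S \<and> tuple_pattern F1 F2 c (parcs G) f))"
proof -
  have "(\<forall>C\<in>components (delete_verts G S). C \<in> \<P>1 \<or> C \<in> \<P>2) \<longleftrightarrow>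
    \<not> (\<exists>f. f ` {..<c} \<subseteq> pverts G - S \<and> tuple_pattern F1 F2 c (parcs G) f)" for S
  proof -
    have del: "delete_verts G S = induced G (pverts G - S)"
      using pair_graph_arcs(2)[OF assms(8)] by (auto simp: delete_verts_def induced_def)
    have pg: "pair_graph (induced G (pverts G - S))" using assms(8) by (intro pair_graph_induced) auto
    have "tuple_pattern F1 F2 c (parcs (induced G (pverts G - S))) f \<longleftrightarrow> tuple_pattern F1 F2 c (parcs G) f"
      if f: "f ` {..<c} \<subseteq> pverts G - S" for f
    proof -
      have "parcs (induced G (pverts G - S)) \<inter> f ` {..<c} \<times> f ` {..<c} = parcs G \<inter> f ` {..<c} \<times> f ` {..<c}"
        using f by (auto simp: induced_def)
      then have "conn (parcs (induced G (pverts G - S))) (f ` {..<c}) \<longleftrightarrow> conn (parcs G) (f ` {..<c})"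
        by (simp add: conn_def)
      moreover have "embeds H (parcs (induced G (pverts G - S))) (f ` {..<c}) \<phi> \<longleftrightarrow>
          embeds H (parcs G) (f ` {..<c}) \<phi>" for H \<phi>
      proof -
        have "\<phi> u \<in> pverts G - S" if "\<phi> ` pverts H \<subseteq> f ` {..<c}" "u \<in> pverts H" for u
          using that f by blast
        then show ?thesis unfolding embeds_def induced_def by auto
      qed
      ultimately show ?thesis by (simp add: tuple_pattern_iff hits_def)
    qed
    then show ?thesis
      unfolding del components_tuple_iff[OF assms(1-7) pg] by auto
  qed
  then show ?thesis unfolding deletable_def by simp
qed

section \<open>Total correctness with time bounds\<close>

text \<open>\<open>exec\<close> counts steps exactly, which varies with the branches taken; an upper
  bound can be weakened until both branches of a test share it.\<close>

definition runs :: "com \<Rightarrow> (nat \<Rightarrow> nat) \<Rightarrow> (nat \<Rightarrow> nat) \<Rightarrow> nat \<Rightarrow>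
    ((nat \<Rightarrow> nat) \<Rightarrow> (nat \<Rightarrow> nat) \<Rightarrow> bool) \<Rightarrow> bool" where
  "runs p R M T Q \<longleftrightarrow> (\<exists>t R' M'. exec p (R, M) t (R', M') \<and> t \<le> T \<and> Q R' M')"

lemma runsI: "exec p (R, M) t (R', M') \<Longrightarrow> t \<le> T \<Longrightarrow> Q R' M' \<Longrightarrow> runs p R M T Q"
  by (auto simp: runs_def)

lemma runs_mono:
  "runs p R M T Q \<Longrightarrow> T \<le> T' \<Longrightarrow> (\<And>R' M'. Q R' M' \<Longrightarrow> Q' R' M') \<Longrightarrow> runs p R M T' Q'"
  unfolding runs_def by (meson order_trans)

lemma runs_Const: "Q (R(x := a)) M \<Longrightarrow> 1 \<le> T \<Longrightarrow> runs (Const x a) R M T Q"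
  by (rule runsI[OF exec.intros(1)])

lemma runs_Copy: "Q (R(x := R y)) M \<Longrightarrow> 1 \<le> T \<Longrightarrow> runs (Copy x y) R M T Q"
  by (rule runsI[OF exec.intros(2)])

lemma runs_Inc: "Q (R(x := Suc (R x))) M \<Longrightarrow> 1 \<le> T \<Longrightarrow> runs (Inc x) R M T Q"
  by (rule runsI[OF exec.intros(3)]) auto

lemma runs_Load: "Q (R(x := M (R y))) M \<Longrightarrow> 1 \<le> T \<Longrightarrow> runs (Load x y) R M T Q"
  by (rule runsI[OF exec.intros(5)])

lemma runs_Store: "Q R (M(R x := R y)) \<Longrightarrow> 1 \<le> T \<Longrightarrow> runs (Store x y) R M T Q"
  by (rule runsI[OF exec.intros(6)])

lemma runs_Seq:
  assumes "runs p R M Ta P" "\<And>R' M'. P R' M' \<Longrightarrow> runs q R' M' Tb Q" "Ta + Tb \<le> T"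
  shows "runs (Seq p q) R M T Q"
proof -
  obtain t R' M' where 1: "exec p (R, M) t (R', M')" "t \<le> Ta" "P R' M'"
    using assms(1) by (auto simp: runs_def)
  obtain u R'' M'' where 2: "exec q (R', M') u (R'', M'')" "u \<le> Tb" "Q R'' M''"
    using assms(2)[OF 1(3)] by (auto simp: runs_def)
  show ?thesis using exec.intros(7)[OF 1(1) 2(1)] by (rule runsI) (use 1 2 assms(3) in auto)
qed

lemma runs_If:
  assumes "R x < R y \<Longrightarrow> runs p R M T Q" "\<not> R x < R y \<Longrightarrow> runs q R M T Q" "T + 1 \<le> T'"
  shows "runs (IfLess x y p q) R M T' Q"
proof (cases "R x < R y")
  case True
  then obtain t R' M' where 1: "exec p (R, M) t (R', M')" "t \<le> T" "Q R' M'"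
    using assms(1) by (auto simp: runs_def)
  show ?thesis using exec.intros(8)[OF True 1(1)] by (rule runsI) (use 1 assms(3) in auto)
next
  case False
  then obtain t R' M' where 1: "exec q (R, M) t (R', M')" "t \<le> T" "Q R' M'"
    using assms(2) by (auto simp: runs_def)
  show ?thesis using exec.intros(9)[OF False 1(1)] by (rule runsI) (use 1 assms(3) in auto)
qed

text \<open>The invariant is indexed by the number of completed iterations, which fixes that number
  in advance: \<open>N\<close> bodies and \<open>N + 1\<close> tests.\<close>

lemma runs_While:
  assumes "P 0 R M"
    and "\<And>i R M. i < N \<Longrightarrow> P i R M \<Longrightarrow> R x < R y \<and> runs p R M T (P (Suc i))"
    and "\<And>R M. P N R M \<Longrightarrow> \<not> R x < R y"
  shows "runs (WhileLess x y p) R M (N * (T + 1) + 1) (P N)"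
proof -
  have "runs (WhileLess x y p) R M ((N - i) * (T + 1) + 1) (P N)" if "P i R M" "i \<le> N" for i R M
    using that
  proof (induction "N - i" arbitrary: i R M)
    case 0
    then have N: "P N R M" by simp
    show ?case using exec.intros(10)[of R x y, OF assms(3)[OF N]] N by (intro runsI) auto
  next
    case (Suc d)
    then have "i < N" by simp
    with Suc.prems assms(2) have xy: "R x < R y" and "runs p R M T (P (Suc i))" by auto
    then obtain t R' M' where 1: "exec p (R, M) t (R', M')" "t \<le> T" "P (Suc i) R' M'"
      by (auto simp: runs_def)
    have "runs (WhileLess x y p) R' M' ((N - Suc i) * (T + 1) + 1) (P N)"
      using Suc 1(3) \<open>i < N\<close> by (intro Suc.hyps(1)) auto
    then obtain u R'' M'' where 2: "exec (WhileLess x y p) (R', M') u (R'', M'')"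
        "u \<le> (N - Suc i) * (T + 1) + 1" "P N R'' M''"
      by (auto simp: runs_def)
    have "t + u + 1 \<le> Suc (N - Suc i) * (T + 1) + 1" using 1 2 by simp
    also have "Suc (N - Suc i) = N - i" using \<open>i < N\<close> by simp
    finally show ?case using exec.intros(11)[OF xy 1(1) 2(1)] 2(3) by (intro runsI)
  qed
  from this[of 0] assms(1) show ?thesis by simp
qed

section \<open>Stepwise execution of straight-line code\<close>

lemma runs_Seq_Const:
  "runs q (R(x := a)) M Tb Q \<Longrightarrow> Tb + 1 \<le> T \<Longrightarrow> runs (Seq (Const x a) q) R M T Q"
  by (rule runs_Seq[where P = "\<lambda>R' M'. R' = R(x := a) \<and> M' = M" and Ta = 1]) (auto intro: runs_Const)

lemma runs_Seq_Copy:
  "runs q (R(x := R y)) M Tb Q \<Longrightarrow> Tb + 1 \<le> T \<Longrightarrow> runs (Seq (Copy x y) q) R M T Q"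
  by (rule runs_Seq[where P = "\<lambda>R' M'. R' = R(x := R y) \<and> M' = M" and Ta = 1]) (auto intro: runs_Copy)

lemma runs_Seq_Inc:
  "runs q (R(x := Suc (R x))) M Tb Q \<Longrightarrow> Tb + 1 \<le> T \<Longrightarrow> runs (Seq (Inc x) q) R M T Q"
  by (rule runs_Seq[where P = "\<lambda>R' M'. R' = R(x := Suc (R x)) \<and> M' = M" and Ta = 1]) (auto intro: runs_Inc)

lemma runs_Seq_Load:
  "runs q (R(x := M (R y))) M Tb Q \<Longrightarrow> Tb + 1 \<le> T \<Longrightarrow> runs (Seq (Load x y) q) R M T Q"
  by (rule runs_Seq[where P = "\<lambda>R' M'. R' = R(x := M (R y)) \<and> M' = M" and Ta = 1]) (auto intro: runs_Load)

lemma runs_Seq_Store: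
  "runs q R (M(R x := R y)) Tb Q \<Longrightarrow> Tb + 1 \<le> T \<Longrightarrow> runs (Seq (Store x y) q) R M T Q"
  by (rule runs_Seq[where P = "\<lambda>R' M'. R' = R \<and> M' = M(R x := R y)" and Ta = 1]) (auto intro: runs_Store)

definition For :: "nat \<Rightarrow> nat \<Rightarrow> com \<Rightarrow> com" where
  "For x y p = Seq (Const x 0) (WhileLess x y (Seq p (Inc x)))"

text \<open>Each iteration pays \<open>2\<close> for the increment and the test, and the loop pays
  \<open>2\<close> more for the initialisation and the failing test. The body must preserve both the
  counter and the bound.\<close>

lemma runs_For:
  assumes "x \<noteq> y" "P 0 (R(x := 0)) M"
    and "\<And>i R' M'. i < R y \<Longrightarrow> P i R' M' \<Longrightarrow> R' x = i \<Longrightarrow> R' y = R y \<Longrightarrow>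
      runs p R' M' T (\<lambda>R'' M''. R'' x = i \<and> R'' y = R y \<and> P (Suc i) (R''(x := Suc i)) M'')"
    and "\<And>R' M'. P (R y) R' M' \<Longrightarrow> R' x = R y \<Longrightarrow> Q R' M'"
    and "R y * (T + 2) + 2 \<le> T'"
  shows "runs (For x y p) R M T' Q"
  unfolding For_def
proof (rule runs_Seq[where Tb = "R y * (T + 1 + 1) + 1"])
  show "runs (Const x 0) R M 1 (\<lambda>R' M'. R' = R(x := 0) \<and> M' = M)" by (rule runs_Const) auto
  fix R' M' assume "R' = R(x := 0) \<and> M' = M"
  then have *: "R' = R(x := 0)" "M' = M" by auto
  let ?I = "\<lambda>i R' M'. P i R' M' \<and> R' x = i \<and> R' y = R y"
  have "runs (WhileLess x y (Seq p (Inc x))) R' M' (R y * (T + 1 + 1) + 1) (?I (R y))"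
  proof (rule runs_While[where P = ?I])
    show "?I 0 R' M'" using assms(1,2) * by simp
    fix i R1 M1 assume i: "i < R y" "?I i R1 M1"
    have "runs (Seq p (Inc x)) R1 M1 (T + 1) (?I (Suc i))"
      by (rule runs_Seq[OF assms(3)[OF i(1)]]) (use i assms(1) in \<open>auto intro!: runs_Inc\<close>)
    then show "R1 x < R1 y \<and> runs (Seq p (Inc x)) R1 M1 (T + 1) (?I (Suc i))" using i by simp
  qed auto
  then show "runs (WhileLess x y (Seq p (Inc x))) R' M' (R y * (T + 1 + 1) + 1) Q"
    by (rule runs_mono) (use assms(4) in auto)
qed (use assms(5) in auto)

section \<open>Frame conditions on registers\<close>

definition same_outside :: "nat set \<Rightarrow> (nat \<Rightarrow> nat) \<Rightarrow> (nat \<Rightarrow> nat) \<Rightarrow> bool" where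
  "same_outside U R R' \<longleftrightarrow> (\<forall>r. r \<notin> U \<longrightarrow> R' r = R r)"

lemma same_outsideD: "same_outside U R R' \<Longrightarrow> r \<notin> U \<Longrightarrow> R' r = R r"
  by (simp add: same_outside_def)

lemma same_outside_refl [simp]: "same_outside U R R"
  by (simp add: same_outside_def)

lemma same_outside_update [simp]: "x \<in> U \<Longrightarrow> same_outside U R (R'(x := a)) = same_outside U R R'"
  by (auto simp: same_outside_def)

lemma same_outside_trans:
  "same_outside U R R' \<Longrightarrow> same_outside V R' R'' \<Longrightarrow> U \<subseteq> W \<Longrightarrow> V \<subseteq> W \<Longrightarrow> same_outside W R R''"
  unfolding same_outside_def by (metis subsetD)

section \<open>The search program\<close>

text \<open>
  Registers with a fixed role; from number 20 on they hold the current tuple. In the statements about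
  the program the registers appear by number. The memory is used as a matrix with rows of length \<open>n\<close>:
  rows \<open>0, \<dots>, n - 1\<close> are the adjacency matrix, row \<open>n\<close> marks the deleted vertices, and row \<open>n + 1\<close>
  holds the current digit string, which fits because the search is only run if \<open>k < n\<close>.
\<close>

abbreviation (input) "rN \<equiv> 0::nat"
abbreviation (input) "rK \<equiv> 1::nat"
abbreviation (input) "rZero \<equiv> 2::nat"
abbreviation (input) "rN1 \<equiv> 3::nat"
abbreviation (input) "rC \<equiv> 4::nat"
abbreviation (input) "rAddr \<equiv> 5::nat"
abbreviation (input) "rI \<equiv> 6::nat"
abbreviation (input) "rJ \<equiv> 7::nat"
abbreviation (input) "rBit \<equiv> 8::nat"
abbreviation (input) "rFound \<equiv> 9::nat"
abbreviation (input) "rV \<equiv> 10::nat"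
abbreviation (input) "rDigit \<equiv> 11::nat"
abbreviation (input) "rPos \<equiv> 12::nat"
abbreviation (input) "rCarry \<equiv> 13::nat"
abbreviation (input) "rGo \<equiv> 14::nat"
abbreviation (input) "rResult \<equiv> 15::nat"
abbreviation (input) "rOne \<equiv> 16::nat"
abbreviation (input) "rTmp \<equiv> 17::nat"
abbreviation (input) "rT j \<equiv> 20 + (j::nat)"

abbreviation (input) "Skip \<equiv> Copy 0 0"

lemma runs_Skip: "Q R M \<Longrightarrow> 1 \<le> T \<Longrightarrow> runs Skip R M T Q"
  by (rule runs_Copy) auto

definition IfEq :: "nat \<Rightarrow> nat \<Rightarrow> com \<Rightarrow> com" where
  "IfEq x y p = IfLess x y Skip (IfLess y x Skip p)"

lemma runs_IfEq:
  assumes "R x = R y \<Longrightarrow> runs p R M T Q" "R x \<noteq> R y \<Longrightarrow> Q R M" "1 \<le> T" "T + 2 \<le> T'"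
  shows "runs (IfEq x y p) R M T' Q"
  unfolding IfEq_def
proof (rule runs_If[where T = "T + 1"])
  show "runs (IfLess y x Skip p) R M (T + 1) Q" if "\<not> R x < R y"
    by (rule runs_If[where T = T]) (use assms that in \<open>auto intro!: runs_Skip\<close>)
qed (use assms in \<open>auto intro!: runs_Skip\<close>)

text \<open>The machine can neither add nor multiply, so the offset of a row is produced by unit
  increments; a single memory access thus takes quadratic time.\<close>

definition addr :: "nat \<Rightarrow> nat \<Rightarrow> com" where
  "addr x y = Seq (Copy rAddr y) (For rI x (For rJ rN (Inc rAddr)))"

definition addr_time :: "nat \<Rightarrow> nat" where
  "addr_time n = 3 + (n + 1) * (n * 3 + 4)"

lemma runs_addr:
  assumes "x \<notin> {5, 6, 7}" "R 0 = n" "R x \<le> n + 1" "addr_time n \<le> T"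
    and "\<And>R'. R' 5 = R x * n + R y \<Longrightarrow> same_outside {5, 6, 7} R R' \<Longrightarrow> Q R' M"
  shows "runs (addr x y) R M T Q"
  unfolding addr_def
proof (rule runs_Seq[where Tb = "(n + 1) * (n * 3 + 4) + 2"])
  show "runs (Copy rAddr y) R M 1 (\<lambda>R' M'. R' = R(5 := R y) \<and> M' = M)" by (rule runs_Copy) auto
  show "1 + ((n + 1) * (n * 3 + 4) + 2) \<le> T" using assms(4) by (simp add: addr_time_def)
  fix R' M' assume "R' = R(5 := R y) \<and> M' = M"
  then have R': "R' = R(5 := R y)" "M' = M" by auto
  have Rx: "R' x = R x" "R' 0 = n" using R' assms(1,2) by auto
  let ?P = "\<lambda>i R'' M''. M'' = M \<and> R'' 5 = R y + i * n \<and> same_outside {5, 6, 7} R R''"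
  show "runs (For rI x (For rJ rN (Inc rAddr))) R' M' ((n + 1) * (n * 3 + 4) + 2) Q"
  proof (rule runs_For[where P = ?P and T = "n * 3 + 2"])
    show "6 \<noteq> x" "?P 0 (R'(6 := 0)) M'" using R' assms(1) by auto
    have "n * 3 + 2 + 2 = n * 3 + 4" by simp
    then have "R' x * (n * 3 + 2 + 2) \<le> (n + 1) * (n * 3 + 4)"
      unfolding Rx using assms(3) by (metis mult_le_mono1)
    then show "R' x * (n * 3 + 2 + 2) + 2 \<le> (n + 1) * (n * 3 + 4) + 2"
      by (simp only: add_le_cancel_right)
  next
    fix R1 M1 assume 1: "?P (R' x) R1 M1"
    then show "Q R1 M1" using assms(5)[of R1] Rx by (auto simp: add.commute)
  next
    fix i R1 M1 assume i: "i < R' x" "?P i R1 M1" "R1 6 = i" "R1 x = R' x"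
    have n: "R1 0 = n" using i(2) same_outsideD[of _ R R1 0] assms(2) by auto
    let ?P' = "\<lambda>j R'' M''. M'' = M \<and> R'' 5 = R y + i * n + j \<and> same_outside {5, 6, 7} R R'' \<and> R'' 6 = i"
    show "runs (For rJ rN (Inc rAddr)) R1 M1 (n * 3 + 2)
      (\<lambda>R'' M''. R'' 6 = i \<and> R'' x = R' x \<and> ?P (Suc i) (R''(6 := Suc i)) M'')"
    proof (rule runs_For[where P = ?P' and T = 1])
      show "?P' 0 (R1(7 := 0)) M1" using i by auto
      show "R1 0 * (1 + 2) + 2 \<le> n * 3 + 2" using n by simp
    next
      fix j R2 M2 assume "?P' j R2 M2" "R2 7 = j" "R2 0 = R1 0"
      then show "runs (Inc 5) R2 M2 1 (\<lambda>R'' M''. R'' 7 = j \<and> R'' 0 = R1 0 \<and> ?P' (Suc j) (R''(7 := Suc j)) M'')"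
        by (intro runs_Inc) auto
    next
      fix R2 M2 assume "?P' (R1 0) R2 M2" "R2 7 = R1 0"
      then show "R2 6 = i \<and> R2 x = R' x \<and> ?P (Suc i) (R2(6 := Suc i)) M2"
        using n same_outsideD[of _ R R2 x] assms(1) Rx by (auto simp: algebra_simps)
    qed simp
  qed
qed


lemma runs_Seq_addr:
  assumes "x \<notin> {5, 6, 7}" "R 0 = n" "R x \<le> n + 1"
    and "\<And>R'. R' 5 = R x * n + R y \<Longrightarrow> same_outside {5, 6, 7} R R' \<Longrightarrow> runs q R' M Tb Q"
    and "addr_time n + Tb \<le> T"
  shows "runs (Seq (addr x y) q) R M T Q"
  by (rule runs_Seq[where P = "\<lambda>R' M'. M' = M \<and> R' 5 = R x * n + R y \<and> same_outside {5, 6, 7} R R'",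
      OF runs_addr[OF assms(1-3) order_refl] _ assms(5)]) (use assms(4) in auto)

datatype test = Adj nat nat | Eq nat nat | Mark nat

fun test_com :: "test \<Rightarrow> com" where
  "test_com (Adj i j) = Seq (addr (rT i) (rT j)) (Load rBit rAddr)"
| "test_com (Eq i j) = Seq (Const rBit 0)
(IfEq (rT i) (rT j) (Const rBit 1))"
| "test_com (Mark i) = Seq (addr rN (rT i)) (Load rBit rAddr)"

text \<open>The set \<open>A\<close> of positive answers exists only while the program text is
  generated. The text grows exponentially in the number of tests, a constant for fixed
  \<open>c\<close>, whereas a run follows a single path.\<close>

primrec decision_tree :: "test list \<Rightarrow> (test set \<Rightarrow> com) \<Rightarrow> test set \<Rightarrow> com" where
  "decision_tree [] f A = f A"
| "decision_tree (t # ts) f A =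
     Seq (test_com t) (IfLess rZero rBit (decision_tree ts f (insert t A)) (decision_tree ts f A))"

text \<open>Register numbers are fixed in the program text, so the tuple entry named by
  \<open>rDigit\<close> is found by comparison with every possible index.\<close>

primrec select :: "nat \<Rightarrow> com" where
  "select 0 = Skip"
| "select (Suc j) = Seq (select j) (Seq (Const rTmp j)
(IfEq rDigit rTmp (Copy rV (rT j))))"

definition tests :: "nat \<Rightarrow> test list" where
  "tests c = [Adj i j. i \<leftarrow> [0..<c], j \<leftarrow> [0..<c]] @ [Eq i j. i \<leftarrow> [0..<c], j \<leftarrow> [0..<c]] @ map Mark [0..<c]"

lemma set_tests:
  "set (tests c) = {Adj i j |i j. i < c \<and> j < c} \<union> {Eq i j |i j. i < c \<and> j < c} \<union> Mark ` {..<c}"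
  by (auto simp: tests_def)

text \<open>The last entry varies slowest, in agreement with the loops of \<open>nest\<close>; hence
  the first bad tuple met by the program is the first one in this list.\<close>

primrec tuples :: "nat \<Rightarrow> nat \<Rightarrow> nat list list" where
  "tuples n 0 = [[]]"
| "tuples n (Suc j) = concat (map (\<lambda>x. map (\<lambda>xs. xs @ [x]) (tuples n j)) [0..<n])"

lemma set_tuples: "set (tuples n j) = {xs. length xs = j \<and> set xs \<subseteq> {..<n}}"
proof (induction j)
  case (Suc j)
  have "xs \<in> set (tuples n (Suc j)) \<longleftrightarrow> length xs = Suc j \<and> set xs \<subseteq> {..<n}" for xs
    using Suc by (cases xs rule: rev_cases) auto
  then show ?case by blast
qed auto

text \<open>For the program, the graph-theoretic condition is an arbitrary predicate
  \<open>pat\<close> on two finite tables; \<open>pat_cong\<close> says that nothing beyond the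
  \<open>c\<close> positions matters.\<close>

locale search =
  fixes pat :: "(nat \<Rightarrow> nat \<Rightarrow> bool) \<Rightarrow> (nat \<Rightarrow> nat \<Rightarrow> bool) \<Rightarrow> bool"
    and c :: nat
  assumes pat_cong: "\<And>adj adj' eq eq'. (\<And>i j. i < c \<Longrightarrow> j < c \<Longrightarrow> adj i j = adj' i j) \<Longrightarrow>
      (\<And>i j. i < c \<Longrightarrow> j < c \<Longrightarrow> eq i j = eq' i j) \<Longrightarrow> pat adj eq = pat adj' eq'"
    and c_pos: "0 < c"
begin

text \<open>
  The program is not uniform in the families: the verdict for each outcome of the tests is
  compiled into the corresponding leaf of the decision tree.
\<close>

definition leaf :: "test set \<Rightarrow> com" where
  "leaf A = (if pat (\<lambda>i j. Adj i j \<in> A) (\<lambda>i j. Eq i j \<in> A) \<and> (\<forall>i<c. Mark i \<notin> A)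
     then Seq (Const rFound 1) (select c) else Skip)"

text \<open>The loops cannot be left early. After a hit, the flag turns the remaining iterations
  into no-ops, so that the entry selected from the first bad tuple survives.\<close>

definition body :: com where
  "body = IfLess rZero rFound Skip (decision_tree (tests c) leaf {})"

primrec nest :: "nat \<Rightarrow> com" where
  "nest 0 = body"
| "nest (Suc j) = For (rT j) rN (nest j)"

definition find_bad :: com where
  "find_bad = Seq (Const rFound 0) (nest c)"

definition clear :: com where
  "clear = For rV rN (Seq (addr rN rV) (Store rAddr rZero))"

text \<open>The search after the loop marks nothing; it only checks whether a bad tuple has survived
  the \<open>k\<close> marks.\<close>

definition attempt :: com where
  "attempt = Seq (For rPos rK (Seq (addr rN1 rPos) (Seq (Load rDigit rAddr) (Seq find_bad
     (IfLess rZero rFound (Seq (addr rN rV) (Store rAddr rOne)) Skip))))) find_bad"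

text \<open>Adds one to the digit string, least significant digit first. A carry out of the last
  position means that all strings have been tried.\<close>

definition increment :: com where
  "increment = Seq (Const rCarry 1) (For rPos rK (IfLess rZero rCarry
     (Seq (addr rN1 rPos) (Seq (Load rDigit rAddr) (Seq (Inc rDigit)
       (IfLess rDigit rC (Seq (Store rAddr rDigit) (Const rCarry 0)) (Store rAddr rZero))))) Skip))"

definition round :: com where
  "round = Seq clear (Seq attempt (Seq (IfLess rZero rFound Skip (Const rResult 1))
     (Seq increment (IfLess rZero rCarry (Const rGo 0) Skip))))"

text \<open>For \<open>k >= n\<close> all vertices may be deleted and no component is left, so the
  answer is yes without any search.\<close>

definition main :: com where
  "main = IfLess rK rN
     (Seq (Copy rN1 rN) (Seq (Inc rN1) (Seq (Const rC c) (Seq (Const rOne 1) (Seq (Const rGo 1)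
       (Seq (WhileLess rZero rGo round) (Copy rN rResult)))))))
     (Const rN 1)"

end

lemma runs_select:
  assumes "4 * j + 1 \<le> T"
  shows "runs (select j) R M T (\<lambda>R' M'. M' = M \<and> same_outside {10, 17} R R' \<and>
    R' 10 = (if R 11 < j then R (20 + R 11) else R 10))"
  using assms
proof (induction j arbitrary: T)
  case 0
  then show ?case by (auto intro!: runs_Skip)
next
  case (Suc j)
  show ?case unfolding select.simps
  proof (rule runs_Seq[OF Suc.IH[OF order_refl]])
    fix R' M' assume *: "M' = M \<and> same_outside {10, 17} R R' \<and>
        R' 10 = (if R 11 < j then R (20 + R 11) else R 10)"
    then have "R' 11 = R 11" "R' (20 + j) = R (20 + j)"
      by (simp_all add: same_outside_def)
    with * show "runs (Seq (Const 17 j) (IfEq 11 17 (Copy 10 (20 + j)))) R' M' 4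
       (\<lambda>R' M'. M' = M \<and> same_outside {10, 17} R R' \<and>
         R' 10 = (if R 11 < Suc j then R (20 + R 11) else R 10))"
      by (intro runs_Seq[where P = "\<lambda>R'' M''. R'' = R'(17 := j) \<and> M'' = M'" and Ta = 1 and Tb = 3]
          runs_Const runs_IfEq[where T = 1] runs_Copy)
        (auto simp: less_Suc_eq)
  qed (use Suc.prems in auto)
qed

section \<open>Polynomial bounds on the running time\<close>

definition body_time :: "nat \<Rightarrow> nat \<Rightarrow> nat" where
  "body_time c n = length (tests c) * (addr_time n + 4) + 4 * c + 3"

primrec nest_time :: "nat \<Rightarrow> nat \<Rightarrow> nat \<Rightarrow> nat" where
  "nest_time c n 0 = body_time c n"
| "nest_time c n (Suc j) = n * (nest_time c n j + 2) + 2"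

definition find_time :: "nat \<Rightarrow> nat \<Rightarrow> nat" where
  "find_time c n = nest_time c n c + 1"

definition clear_time :: "nat \<Rightarrow> nat" where
  "clear_time n = n * (addr_time n + 3) + 2"

definition attempt_time :: "nat \<Rightarrow> nat \<Rightarrow> nat" where
  "attempt_time c n = n * (2 * addr_time n + find_time c n + 5) + 2 + find_time c n"

definition increment_time :: "nat \<Rightarrow> nat" where
  "increment_time n = n * (addr_time n + 8) + 3"

definition round_time :: "nat \<Rightarrow> nat \<Rightarrow> nat" where
  "round_time c n = clear_time n + attempt_time c n + increment_time n + 4"

text \<open>The base \<open>n + 1\<close> keeps the bound positive for the empty graph.\<close>

definition poly_bounded :: "(nat \<Rightarrow> nat) \<Rightarrow> bool" where
  "poly_bounded f \<longleftrightarrow> (\<exists>a b. \<forall>n. f n \<le> a * (n + 1) ^ b)"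

lemma poly_bounded_const: "poly_bounded (\<lambda>n. a)"
  unfolding poly_bounded_def by (intro exI[of _ a] exI[of _ 0]) simp

lemma poly_bounded_id: "poly_bounded (\<lambda>n. n)"
  unfolding poly_bounded_def by (intro exI[of _ 1] exI[of _ 1]) simp

lemma poly_bounded_add:
  assumes "poly_bounded f" "poly_bounded g"
  shows "poly_bounded (\<lambda>n. f n + g n)"
proof -
  obtain a b a' b' where f: "\<And>n. f n \<le> a * (n + 1) ^ b" and g: "\<And>n. g n \<le> a' * (n + 1) ^ b'"
    using assms by (auto simp: poly_bounded_def)
  have "f n + g n \<le> (a + a') * (n + 1) ^ (b + b')" for n
  proof -
    have "f n \<le> a * (n + 1) ^ (b + b')"
      by (rule order_trans[OF f mult_le_mono2[OF power_increasing]]) auto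
    moreover have "g n \<le> a' * (n + 1) ^ (b + b')"
      by (rule order_trans[OF g mult_le_mono2[OF power_increasing]]) auto
    ultimately show ?thesis unfolding add_mult_distrib by (rule add_mono)
  qed
  then show ?thesis unfolding poly_bounded_def by blast
qed

lemma poly_bounded_mult:
  assumes "poly_bounded f" "poly_bounded g"
  shows "poly_bounded (\<lambda>n. f n * g n)"
proof -
  obtain a b a' b' where f: "\<And>n. f n \<le> a * (n + 1) ^ b" and g: "\<And>n. g n \<le> a' * (n + 1) ^ b'"
    using assms by (auto simp: poly_bounded_def)
  have "f n * g n \<le> (a * a') * (n + 1) ^ (b + b')" for n
    using mult_le_mono[OF f[of n] g[of n]] by (simp add: power_add mult_ac)
  then show ?thesis unfolding poly_bounded_def by blast
qed

lemmas poly_bounded_intros = poly_bounded_const poly_bounded_id poly_bounded_add poly_bounded_mult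

text \<open>Every nested loop contributes a factor \<open>n\<close>; the degree grows with
  \<open>c\<close>, which is a constant.\<close>

lemma poly_bounded_round_time: "poly_bounded (\<lambda>n. round_time c n)"
proof -
  have addr: "poly_bounded (\<lambda>n. addr_time n)"
    unfolding addr_time_def by (intro poly_bounded_intros)
  have "poly_bounded (\<lambda>n. nest_time c n j)" for j
  proof (induction j)
    case 0
    then show ?case unfolding nest_time.simps body_time_def by (intro poly_bounded_intros addr)
  next
    case (Suc j)
    then show ?case unfolding nest_time.simps by (intro poly_bounded_intros)
  qed
  then show ?thesis
    unfolding round_time_def clear_time_def attempt_time_def increment_time_def find_time_def
    by (intro poly_bounded_intros addr)
qed

section \<open>Running time and correctness of the search\<close>

locale search_instance = search +
  fixes n k :: nat and E :: "(nat \<times> nat) set"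
begin

fun test_val :: "(nat \<Rightarrow> nat) \<Rightarrow> nat set \<Rightarrow> test \<Rightarrow> bool" where
  "test_val f S (Adj i j) \<longleftrightarrow> (f i, f j) \<in> E"
| "test_val f S (Eq i j) \<longleftrightarrow> f i = f j"
| "test_val f S (Mark i) \<longleftrightarrow> f i \<in> S"

definition represents :: "(nat \<Rightarrow> nat) \<Rightarrow> nat set \<Rightarrow> (nat \<Rightarrow> nat) \<Rightarrow> bool" where
  "represents M S ds \<longleftrightarrow> (\<forall>x<n. \<forall>y<n. M (x * n + y) = of_bool ((x, y) \<in> E)) \<and>
     (\<forall>v<n. M (n * n + v) = of_bool (v \<in> S)) \<and> (\<forall>i<k. M ((n + 1) * n + i) = ds i)"

definition bad :: "nat set \<Rightarrow> nat list \<Rightarrow> bool" where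
  "bad S xs \<longleftrightarrow> (\<forall>i<c. xs ! i \<notin> S) \<and> pat (\<lambda>i j. (xs ! i, xs ! j) \<in> E) (\<lambda>i j. xs ! i = xs ! j)"

definition pick :: "nat set \<Rightarrow> nat list option" where
  "pick S = List.find (bad S) (tuples n c)"

text \<open>The effect of one run of \<open>body\<close>: the first hit wins. As a fold, the search
  can start from any intermediate result, which the induction over nested loops requires.\<close>

definition scan :: "nat set \<Rightarrow> nat list \<Rightarrow> nat list option \<Rightarrow> nat list option" where
  "scan S xs r = (case r of None \<Rightarrow> if bad S xs then Some xs else None | Some ys \<Rightarrow> Some ys)"

lemma fold_scan: "fold (scan S) xss r = (case r of None \<Rightarrow> List.find (bad S) xss | Some ys \<Rightarrow> Some ys)"
  by (induction xss arbitrary: r) (auto simp: scan_def split: option.splits)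

text \<open>The flag is always meaningful, the selected entry only for an admissible digit, because
  a search starts without any assumption on the digit register.\<close>

definition reports :: "(nat \<Rightarrow> nat) \<Rightarrow> nat list option \<Rightarrow> bool" where
  "reports R r \<longleftrightarrow> R 9 = of_bool (r \<noteq> None) \<and> (\<forall>xs. r = Some xs \<longrightarrow> R 11 < c \<longrightarrow> R 10 = xs ! R 11)"

lemma runs_test:
  assumes "represents M S ds" "R 0 = n" "\<forall>i<c. R (20 + i) < n" "t \<in> set (tests c)"
  shows "runs (test_com t) R M (addr_time n + 3) (\<lambda>R' M'. M' = M \<and> same_outside {5, 6, 7, 8} R R' \<and>
     R' 8 = of_bool (test_val (\<lambda>i. R (20 + i)) S t))"
proof -
  consider (Adj) i j where "t = Adj i j" "i < c" "j < c" | (Eq) i j where "t = Eq i j" "i < c" "j < c"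
    | (Mark) i where "t = Mark i" "i < c"
    using assms(4) by (auto simp: set_tests)
  then show ?thesis
  proof cases
    case Adj
    have "M (R (20 + i) * n + R (20 + j)) = of_bool ((R (20 + i), R (20 + j)) \<in> E)"
      using assms(1,3) Adj by (auto simp: represents_def)
    then show ?thesis using assms(2,3) Adj unfolding Adj(1) test_com.simps
      by (intro runs_Seq[where Tb = 1] runs_addr[where n = n] runs_Load)
        (auto simp: less_imp_le less_SucI intro: same_outside_trans)
  next
    case Eq
    then show ?thesis unfolding Eq(1) test_com.simps
      by (intro runs_Seq[where P = "\<lambda>R'' M''. R'' = R(8 := 0) \<and> M'' = M" and Ta = 1 and Tb = 3]
          runs_Const runs_IfEq[where T = 1]) (auto simp: addr_time_def)
  next
    case Mark
    have "M (n * n + R (20 + i)) = of_bool (R (20 + i) \<in> S)"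
      using assms(1,3) Mark by (auto simp: represents_def)
    then show ?thesis using assms(2,3) Mark unfolding Mark(1) test_com.simps
      by (intro runs_Seq[where Tb = 1] runs_addr[where n = n] runs_Load)
        (auto intro: same_outside_trans)
  qed
qed


text \<open>Only the leaf that belongs to the true answers is reached, so \<open>f\<close> has to be
  correct for that set alone. The tests overwrite scratch registers only, so their answers can all
  be read off the initial \<open>R\<close>.\<close>

lemma runs_decision_tree:
  assumes M: "represents M S ds"
    and leaf: "\<And>R'. same_outside {5, 6, 7, 8} R R' \<Longrightarrow>
      runs (f (A \<union> {t \<in> set ts. test_val (\<lambda>i. R (20 + i)) S t})) R' M T Q"
    and R: "R 0 = n" "R 2 = 0" "\<forall>i<c. R (20 + i) < n" "set ts \<subseteq> set (tests c)"
    and T: "length ts * (addr_time n + 4) + T \<le> T'"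
  shows "runs (decision_tree ts f A) R M T' Q"
  using leaf R T
proof (induction ts arbitrary: A R T')
  case Nil
  then show ?case using runs_mono[OF Nil(1)[of R]] by simp
next
  case (Cons t ts)
  let ?v = "\<lambda>R t. test_val (\<lambda>i. R (20 + i)) S t"
  show ?case unfolding decision_tree.simps
  proof (rule runs_Seq[OF runs_test[OF M]])
    fix R' M' assume *: "M' = M \<and> same_outside {5, 6, 7, 8} R R' \<and> R' 8 = of_bool (?v R t)"
    then have reg: "R' 0 = n" "R' 2 = 0" "\<And>i. R' (20 + i) = R (20 + i)"
      using Cons.prems by (simp_all add: same_outside_def)
    let ?A = "if ?v R t then insert t A else A"
    have "runs (decision_tree ts f ?A) R' M (length ts * (addr_time n + 4) + T) Q"
    proof (rule Cons.IH)
      fix R'' assume R'': "same_outside {5, 6, 7, 8} R' R''"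
      have "A \<union> {s \<in> set (t # ts). ?v R s} = ?A \<union> {s \<in> set ts. ?v R s}" by auto
      moreover have "runs (f (A \<union> {s \<in> set (t # ts). ?v R s})) R'' M T Q"
        using * R'' by (intro Cons.prems(1)) (auto intro: same_outside_trans)
      ultimately show "runs (f (?A \<union> {s \<in> set ts. ?v R' s})) R'' M T Q"
        using reg by simp
    qed (use reg Cons.prems in auto)
    then show "runs (IfLess 2 8 (decision_tree ts f (insert t A)) (decision_tree ts f A)) R' M'
        (length ts * (addr_time n + 4) + T + 1) Q"
      using * reg by (intro runs_If[where T = "length ts * (addr_time n + 4) + T"]) (auto split: if_splits)
  qed (use Cons.prems in auto)
qed

lemma runs_body:
  assumes "represents M S ds" "R 0 = n" "R 2 = 0" "\<forall>i<c. R (20 + i) < n" "reports R r"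
  shows "runs body R M (body_time c n) (\<lambda>R' M'. M' = M \<and> same_outside {5, 6, 7, 8, 9, 10, 17} R R' \<and>
     reports R' (scan S (map (\<lambda>i. R (20 + i)) [0..<c]) r))"
proof -
  let ?xs = "map (\<lambda>i. R (20 + i)) [0..<c]"
  let ?A = "{t \<in> set (tests c). test_val (\<lambda>i. R (20 + i)) S t}"
  let ?Q = "\<lambda>R' M'. M' = M \<and> same_outside {5, 6, 7, 8, 9, 10, 17} R R' \<and> reports R' (scan S ?xs r)"
  \<comment> \<open>The answers in \<open>?A\<close> describe the tuple only for positions below
    \<open>c\<close>, and \<open>pat\<close> looks at no others.\<close>
  have "pat (\<lambda>i j. Adj i j \<in> ?A) (\<lambda>i j. Eq i j \<in> ?A) = pat (\<lambda>i j. (?xs ! i, ?xs ! j) \<in> E) (\<lambda>i j. ?xs ! i = ?xs ! j)"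
    by (rule pat_cong) (auto simp: set_tests)
  then have bad_iff: "bad S ?xs \<longleftrightarrow> pat (\<lambda>i j. Adj i j \<in> ?A) (\<lambda>i j. Eq i j \<in> ?A) \<and> (\<forall>i<c. Mark i \<notin> ?A)"
    unfolding bad_def by (auto simp: set_tests)
  have leaf: "runs (leaf ?A) R' M (4 * c + 2) ?Q" if *: "same_outside {5, 6, 7, 8} R R'" and r: "r = None" for R'
  proof (cases "bad S ?xs")
    case True
    have reg: "R' 11 = R 11" "\<And>i. R' (20 + i) = R (20 + i)" using * by (simp_all add: same_outside_def)
    have "leaf ?A = Seq (Const 9 1) (select c)" using True bad_iff by (simp add: leaf_def)
    moreover have "runs (Seq (Const 9 1) (select c)) R' M (4 * c + 2) ?Q"
    proof (rule runs_Seq[OF _ runs_mono[OF runs_select[OF order_refl] order_refl]])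
      show "runs (Const 9 1) R' M 1 (\<lambda>R'' M'. R'' = R'(9 := 1) \<and> M' = M)" by (rule runs_Const) auto
      fix R1 M1 R2 M2
      assume 1: "R1 = R'(9 := 1) \<and> M1 = M"
        and 2: "M2 = M1 \<and> same_outside {10, 17} R1 R2 \<and> R2 10 = (if R1 11 < c then R1 (20 + R1 11) else R1 10)"
      then have "R2 9 = 1" "R2 11 = R 11" using reg by (auto simp: same_outside_def)
      then have "reports R2 (scan S ?xs r)"
        using 1 2 True r reg by (auto simp: reports_def scan_def)
      moreover have "same_outside {5, 6, 7, 8, 9, 10, 17} R R2"
        using 1 2 * by (auto simp: same_outside_def)
      ultimately show "?Q R2 M2" using 1 2 by simp
    qed auto
    ultimately show ?thesis by simp
  next
    case False
    then have "leaf ?A = Skip" using bad_iff by (auto simp: leaf_def)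
    moreover have "reports R' (scan S ?xs r)"
      using False r * assms(5) by (auto simp: reports_def scan_def same_outside_def)
    ultimately show ?thesis using * by (auto intro!: runs_Skip intro: same_outside_trans)
  qed
  show ?thesis unfolding body_def
  proof (rule runs_If[where T = "length (tests c) * (addr_time n + 4) + 4 * c + 2"])
    assume "R 2 < R 9"
    then obtain ys where "r = Some ys" using assms(3,5) by (auto simp: reports_def)
    then show "runs Skip R M (length (tests c) * (addr_time n + 4) + 4 * c + 2) ?Q"
      using assms(5) by (auto intro!: runs_Skip simp: scan_def)
  next
    assume "\<not> R 2 < R 9"
    then have "r = None" using assms(3,5) by (auto simp: reports_def)
    then show "runs (decision_tree (tests c) leaf {}) R M (length (tests c) * (addr_time n + 4) + 4 * c + 2) ?Q"
      using assms leaf by (intro runs_decision_tree[OF assms(1)]) auto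
  qed (simp add: body_time_def)
qed

text \<open>The entries from \<open>j\<close> on are held fixed by the outer loops, so the inner
  nest scans all \<open>j\<close>-tuples extended by this tail.\<close>

lemma runs_nest:
  assumes "represents M S ds" "R 0 = n" "R 2 = 0" "\<forall>i<c. j \<le> i \<longrightarrow> R (20 + i) < n" "reports R r" "j \<le> c"
  shows "runs (nest j) R M (nest_time c n j) (\<lambda>R' M'. M' = M \<and>
     same_outside ({5, 6, 7, 8, 9, 10, 17} \<union> {20..<20 + j}) R R' \<and>
     reports R' (fold (scan S) (map (\<lambda>xs. xs @ map (\<lambda>i. R (20 + i)) [j..<c]) (tuples n j)) r))"
  using assms(2-)
proof (induction j arbitrary: R r)
  case 0
  then show ?case using runs_body[OF assms(1), of R r] by simp
next
  case (Suc j)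
  let ?U = "{5, 6, 7, 8, 9, 10, 17} \<union> {20..<20 + Suc j}"
  let ?rest = "map (\<lambda>i. R (20 + i)) [Suc j..<c]"
  let ?ts = "\<lambda>x. map (\<lambda>xs. xs @ x # ?rest) (tuples n j)"
  let ?P = "\<lambda>i R' M'. M' = M \<and> same_outside ?U R R' \<and>
      reports R' (fold (scan S) (concat (map ?ts [0..<i])) r)"
  show ?case unfolding nest.simps
  proof (rule runs_For[where P = ?P and T = "nest_time c n j"])
    show "?P 0 (R(20 + j := 0)) M" using Suc.prems by (simp add: reports_def)
  next
    fix i R' M' assume i: "i < R 0" "?P i R' M'" "R' (20 + j) = i" "R' 0 = R 0"
    have reg: "R' 2 = 0" "\<And>i. Suc j \<le> i \<Longrightarrow> R' (20 + i) = R (20 + i)"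
      using i(2) Suc.prems by (auto simp: same_outside_def)
    \<comment> \<open>The loop counter is itself entry \<open>j\<close> of the tuple and becomes the
      head of the tail seen by the inner nest.\<close>
    have rest: "map (\<lambda>i. R' (20 + i)) [j..<c] = i # ?rest"
      using Suc.prems(5) i(3) reg by (simp add: upt_conv_Cons)
    have lt: "\<forall>t<c. j \<le> t \<longrightarrow> R' (20 + t) < n"
      using Suc.prems i reg by (metis Suc_leI le_neq_implies_less)
    have "runs (nest j) R' M (nest_time c n j) (\<lambda>R'' M'. M' = M \<and>
        same_outside ({5, 6, 7, 8, 9, 10, 17} \<union> {20..<20 + j}) R' R'' \<and>
        reports R'' (fold (scan S) (?ts i) (fold (scan S) (concat (map ?ts [0..<i])) r)))"
      unfolding rest[symmetric] using i Suc.prems reg lt by (intro Suc.IH) auto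
    moreover have "M' = M" using i(2) by simp
    ultimately show "runs (nest j) R' M' (nest_time c n j)
       (\<lambda>R'' M''. R'' (20 + j) = i \<and> R'' 0 = R 0 \<and> ?P (Suc i) (R''(20 + j := Suc i)) M'')"
      unfolding \<open>M' = M\<close>
    proof (elim runs_mono)
      fix R'' M'' assume *: "M'' = M \<and> same_outside ({5, 6, 7, 8, 9, 10, 17} \<union> {20..<20 + j}) R' R'' \<and>
        reports R'' (fold (scan S) (?ts i) (fold (scan S) (concat (map ?ts [0..<i])) r))"
      then have "same_outside ?U R R''" using i(2) by (auto intro: same_outside_trans)
      moreover have "R'' (20 + j) = i" "R'' 0 = R 0"
        using * i by (auto simp: same_outside_def)
      ultimately show "R'' (20 + j) = i \<and> R'' 0 = R 0 \<and> ?P (Suc i) (R''(20 + j := Suc i)) M''"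
        using * by (simp add: reports_def)
    qed (use i in auto)
  next
    fix R' M' assume "?P (R 0) R' M'"
    then show "M' = M \<and> same_outside ?U R R' \<and>
      reports R' (fold (scan S) (map (\<lambda>xs. xs @ ?rest) (tuples n (Suc j))) r)"
      using Suc.prems(1) by (simp add: map_concat comp_def)
  qed (use Suc.prems in auto)
qed

lemma runs_find_bad:
  assumes "represents M S ds" "R 0 = n" "R 2 = 0"
  shows "runs find_bad R M (find_time c n) (\<lambda>R' M'. M' = M \<and>
     same_outside ({5, 6, 7, 8, 9, 10, 17} \<union> {20..<20 + c}) R R' \<and> reports R' (pick S))"
  unfolding find_bad_def
proof (rule runs_Seq)
  show "runs (Const 9 0) R M 1 (\<lambda>R' M'. R' = R(9 := 0) \<and> M' = M)" by (rule runs_Const) auto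
  fix R' M' assume *: "R' = R(9 := 0) \<and> M' = M"
  have "runs (nest c) R' M (nest_time c n c) (\<lambda>R'' M''. M'' = M \<and>
     same_outside ({5, 6, 7, 8, 9, 10, 17} \<union> {20..<20 + c}) R' R'' \<and>
     reports R'' (fold (scan S) (map (\<lambda>xs. xs @ map (\<lambda>i. R' (20 + i)) [c..<c]) (tuples n c)) None))"
    using assms * by (intro runs_nest) (auto simp: reports_def)
  then show "runs (nest c) R' M' (nest_time c n c) (\<lambda>R'' M''. M'' = M \<and>
     same_outside ({5, 6, 7, 8, 9, 10, 17} \<union> {20..<20 + c}) R R'' \<and> reports R'' (pick S))"
    unfolding conjunct2[OF *]
    by (rule runs_mono) (use * in \<open>auto simp: fold_scan pick_def same_outside_def\<close>)
qed (simp add: find_time_def)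


lemma cell_eq_iff:
  assumes "y < n" "y' < n"
  shows "x * n + y = x' * n + y' \<longleftrightarrow> x = x' \<and> y = (y' :: nat)"
proof -
  have "(x * n + y) div n = x" "(x' * n + y') div n = x'" using assms by auto
  then show ?thesis by (metis add_left_cancel)
qed

text \<open>Distinct cells have distinct addresses, so a mark leaves the matrix intact; the digits
  are safe because \<open>k < n\<close> makes their positions columns of one row.\<close>

lemma represents_mark:
  assumes "represents M S ds" "v < n" "k < n"
  shows "represents (M(n * n + v := of_bool b)) (if b then insert v S else S - {v}) ds"
proof -
  have "x * n + y \<noteq> n * n + v" if "x < n" "y < n" for x y
    using cell_eq_iff[of y v x n] that assms(2) by simp
  moreover have "(n + 1) * n + i \<noteq> n * n + v" if "i < k" for i
    using cell_eq_iff[of i v "n + 1" n] that assms(2,3) by simp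
  ultimately show ?thesis
    using assms(1) unfolding represents_def by (simp del: mult_Suc add: fun_upd_def)
qed

lemma represents_digit:
  assumes "represents M S ds" "i < k" "k < n"
  shows "represents (M((n + 1) * n + i := d)) S (ds(i := d))"
proof -
  have "x * n + y \<noteq> (n + 1) * n + i" if "x \<le> n" "y < n" for x y
    using cell_eq_iff[of y i x "n + 1"] that assms(2,3) by simp
  moreover have "(n + 1) * n + j = (n + 1) * n + i \<longleftrightarrow> j = i" for j by simp
  ultimately show ?thesis
    using assms(1) unfolding represents_def by (auto simp del: mult_Suc)
qed

definition base :: "(nat \<Rightarrow> nat) \<Rightarrow> bool" where
  "base R \<longleftrightarrow> R 0 = n \<and> R 1 = k \<and> R 2 = 0 \<and> R 3 = n + 1 \<and> R 4 = c \<and> R 16 = 1"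

lemma base_same_outside:
  "base R \<Longrightarrow> same_outside U R R' \<Longrightarrow> U \<inter> {0, 1, 2, 3, 4, 16} = {} \<Longrightarrow> base R'"
  unfolding base_def same_outside_def by (metis IntI empty_iff insertCI)

lemma runs_clear:
  assumes "represents M S ds" "base R" "k < n"
  shows "runs clear R M (clear_time n) (\<lambda>R' M'. represents M' {} ds \<and> same_outside {5, 6, 7, 10} R R')"
  unfolding clear_def
proof (rule runs_For[where T = "addr_time n + 1"
      and P = "\<lambda>i R' M'. represents M' (S - {..<i}) ds \<and> same_outside {5, 6, 7, 10} R R'"])
  fix i R1 M1
  assume i: "i < R 0" "represents M1 (S - {..<i}) ds \<and> same_outside {5, 6, 7, 10} R R1"
    "R1 10 = i" "R1 0 = R 0"
  have reg: "R1 0 = n" "R1 2 = 0" "R 0 = n" using i assms(2) by (auto simp: base_def same_outside_def)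
  show "runs (Seq (addr 0 10) (Store 5 2)) R1 M1 (addr_time n + 1) (\<lambda>R'' M''. R'' 10 = i \<and> R'' 0 = R 0 \<and>
      represents M'' (S - {..<Suc i}) ds \<and> same_outside {5, 6, 7, 10} R (R''(10 := Suc i)))"
  proof (rule runs_Seq_addr[where n = n and Tb = 1])
    fix R2 assume "R2 5 = R1 0 * n + R1 10" "same_outside {5, 6, 7} R1 R2"
    then have "R2 5 = n * n + i" "R2 2 = 0" "R2 10 = i" "R2 0 = n" "same_outside {5, 6, 7, 10} R R2"
      using reg i by (auto simp: same_outside_def)
    moreover have "S - {..<i} - {i} = S - {..<Suc i}" by (auto simp: lessThan_Suc)
    ultimately show "runs (Store 5 2) R2 M1 1 (\<lambda>R'' M''. R'' 10 = i \<and> R'' 0 = R 0 \<and>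
      represents M'' (S - {..<Suc i}) ds \<and> same_outside {5, 6, 7, 10} R (R''(10 := Suc i)))"
      using represents_mark[of M1 "S - {..<i}" ds i False] i reg assms(3) by (intro runs_Store) simp_all
  qed (use reg in auto)
next
  \<comment> \<open>Marks are read only below \<open>n\<close>, so elements of \<open>S\<close>
    outside this range are invisible.\<close>
  fix R' M' assume "represents M' (S - {..<R 0}) ds \<and> same_outside {5, 6, 7, 10} R R'"
  then show "represents M' {} ds \<and> same_outside {5, 6, 7, 10} R R'"
    using assms(2) by (auto simp: represents_def base_def)
qed (use assms in \<open>auto simp: clear_time_def base_def algebra_simps\<close>)

text \<open>When no bad tuple is left the set stays as it is, which pads every branch to length
  exactly \<open>k\<close>.\<close>

definition mark_step :: "nat set \<Rightarrow> nat \<Rightarrow> nat set" where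
  "mark_step S d = (case pick S of None \<Rightarrow> S | Some xs \<Rightarrow> insert (xs ! d) S)"

primrec marks :: "(nat \<Rightarrow> nat) \<Rightarrow> nat \<Rightarrow> nat set" where
  "marks ds 0 = {}"
| "marks ds (Suc i) = mark_step (marks ds i) (ds i)"

lemma pick_SomeD:
  assumes "pick S = Some xs"
  shows "length xs = c" "set xs \<subseteq> {..<n}" "bad S xs"
proof -
  have "xs \<in> set (tuples n c)" "bad S xs"
    using assms by (auto simp: pick_def find_Some_iff)
  then show "length xs = c" "set xs \<subseteq> {..<n}" "bad S xs" by (auto simp: set_tuples)
qed

end

context search_instance begin

lemma runs_attempt:
  assumes "represents M {} ds" "base R" "k < n" "\<forall>i<k. ds i < c"
  shows "runs attempt R M (attempt_time c n) (\<lambda>R' M'. represents M' (marks ds k) ds \<and>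
    same_outside ({5, 6, 7, 8, 9, 10, 11, 12, 17} \<union> {20..<20 + c}) R R' \<and> reports R' (pick (marks ds k)))"
  unfolding attempt_def
proof (rule runs_Seq)
  let ?U = "{5, 6, 7, 8, 9, 10, 11, 12, 17} \<union> {20..<20 + c}"
  let ?I = "\<lambda>i R' M'. represents M' (marks ds i) ds \<and> same_outside ?U R R'"
  let ?T = "2 * addr_time n + find_time c n + 3"
  have k: "R 1 = k" using assms(2) by (simp add: base_def)
  show "runs (For 12 1 (Seq (addr 3 12) (Seq (Load 11 5) (Seq find_bad
     (IfLess 2 9 (Seq (addr 0 10) (Store 5 16)) Skip))))) R M (n * (?T + 2) + 2) (?I k)"
  proof (rule runs_For[where P = ?I and T = ?T])
    show "?I 0 (R(12 := 0)) M" using assms(1) by simp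
    show "R 1 * (?T + 2) + 2 \<le> n * (?T + 2) + 2" using k assms(3) by simp
  next
    fix i R1 M1 assume i: "i < R 1" "?I i R1 M1" "R1 12 = i" "R1 1 = R 1"
    have b1: "base R1" using i(2) by (intro base_same_outside[OF assms(2), of ?U]) auto
    let ?Q = "\<lambda>R'' M''. R'' 12 = i \<and> R'' 1 = R 1 \<and> ?I (Suc i) (R''(12 := Suc i)) M''"
    have ik: "i < k" using i(1) k by simp
    show "runs (Seq (addr 3 12) (Seq (Load 11 5) (Seq find_bad
     (IfLess 2 9 (Seq (addr 0 10) (Store 5 16)) Skip)))) R1 M1 ?T ?Q"
    proof (rule runs_Seq_addr[where n = n and Tb = "find_time c n + addr_time n + 3"])
      fix R2 assume R2: "R2 5 = R1 3 * n + R1 12" "same_outside {5, 6, 7} R1 R2"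
      then have "R2 5 = (n + 1) * n + i" using b1 i by (simp add: base_def)
      then have "M1 (R2 5) = ds i" using i(2) ik unfolding represents_def by simp
      define R3 where "R3 = R2(11 := M1 (R2 5))"
      have 3: "same_outside ?U R R3" "base R3" "R3 12 = i" "R3 11 = ds i"
        using i R2(2) b1 \<open>M1 (R2 5) = ds i\<close> by (auto simp: same_outside_def base_def R3_def)
      have "runs (Seq find_bad (IfLess 2 9 (Seq (addr 0 10) (Store 5 16)) Skip)) R3 M1
          (find_time c n + (addr_time n + 2)) ?Q"
      proof (rule runs_Seq[OF runs_find_bad])
        show "represents M1 (marks ds i) ds" using i by simp
        fix R4 M4 assume "M4 = M1 \<and> same_outside ({5, 6, 7, 8, 9, 10, 17} \<union> {20..<20 + c}) R3 R4 \<and>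
            reports R4 (pick (marks ds i))"
        then have 4: "M4 = M1" "same_outside ?U R R4" "base R4" "R4 12 = i" "R4 11 = ds i"
            "reports R4 (pick (marks ds i))"
          using 3 by (auto simp: base_def same_outside_def)
        show "runs (IfLess 2 9 (Seq (addr 0 10) (Store 5 16)) Skip) R4 M4 (addr_time n + 2) ?Q"
        proof (rule runs_If[where T = "addr_time n + 1"])
          assume "R4 2 < R4 9"
          then obtain xs where xs: "pick (marks ds i) = Some xs"
            using 4 by (auto simp: reports_def base_def)
          then have v: "R4 10 = xs ! ds i" using 4 assms(4) ik by (simp add: reports_def)
          have vn: "xs ! ds i < n"
            using pick_SomeD(1,2)[OF xs] assms(4) ik by (metis lessThan_iff nth_mem subsetD)
          show "runs (Seq (addr 0 10) (Store 5 16)) R4 M4 (addr_time n + 1) ?Q"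
          proof (rule runs_Seq_addr[where n = n and Tb = 1])
            fix R5 assume "R5 5 = R4 0 * n + R4 10" "same_outside {5, 6, 7} R4 R5"
            then have 5: "R5 5 = n * n + xs ! ds i" "R5 16 = 1" "R5 12 = i" "R5 1 = R 1" "same_outside ?U R R5"
              using 4 v k by (auto simp: base_def same_outside_def)
            have "represents (M1(n * n + xs ! ds i := of_bool True)) (insert (xs ! ds i) (marks ds i)) ds"
              using represents_mark[of M1 _ ds _ True] i(2) vn assms(3) by simp
            then show "runs (Store 5 16) R5 M4 1 ?Q"
              using 5 4(1) xs by (intro runs_Store) (simp_all add: mark_step_def)
          qed (use 4 in \<open>auto simp: base_def\<close>)
        next
          assume "\<not> R4 2 < R4 9"
          then have "pick (marks ds i) = None"
            using 4 by (auto simp: reports_def base_def)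
          then show "runs Skip R4 M4 (addr_time n + 1) ?Q"
            using 4 i k by (auto intro!: runs_Skip simp: mark_step_def base_def)
        qed simp
      qed (use 3 in \<open>auto simp: base_def\<close>)
      then show "runs (Seq (Load 11 5) (Seq find_bad (IfLess 2 9 (Seq (addr 0 10) (Store 5 16)) Skip)))
          R2 M1 (find_time c n + addr_time n + 3) ?Q"
        unfolding R3_def by (rule runs_Seq_Load) simp
    qed (use b1 in \<open>auto simp: base_def\<close>)
  qed (use k in auto)
  fix R' M' assume *: "?I k R' M'"
  then have b: "base R'" by (intro base_same_outside[OF assms(2), of ?U]) auto
  have "runs find_bad R' M' (find_time c n) (\<lambda>R'' M''. M'' = M' \<and>
     same_outside ({5, 6, 7, 8, 9, 10, 17} \<union> {20..<20 + c}) R' R'' \<and> reports R'' (pick (marks ds k)))"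
    using * b by (intro runs_find_bad) (auto simp: base_def)
  then show "runs find_bad R' M' (find_time c n) (\<lambda>R' M'. represents M' (marks ds k) ds \<and>
    same_outside ?U R R' \<and> reports R' (pick (marks ds k)))"
    by (rule runs_mono) (use * in \<open>auto intro: same_outside_trans\<close>)
qed (simp add: attempt_time_def)


section \<open>Counting in base c\<close>

definition digit :: "nat \<Rightarrow> nat \<Rightarrow> nat" where
  "digit m i = m div c ^ i mod c"

lemma digit_less: "digit m i < c"
  using c_pos by (simp add: digit_def)

text \<open>Divisibility of \<open>m + 1\<close> by \<open>c ^ i\<close> says that the carry reaches
  position \<open>i\<close>. Then \<open>m + 1 = c ^ i * Suc r\<close> while
  \<open>m div c ^ i = r\<close>, so the digit passes from \<open>r mod c\<close> to
  \<open>Suc r mod c\<close>.\<close>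

lemma digit_Suc_carry:
  assumes "c ^ i dvd m + 1"
  shows "digit m i + 1 < c \<longleftrightarrow> \<not> c ^ Suc i dvd m + 1"
    and "digit (m + 1) i = (if digit m i + 1 < c then digit m i + 1 else 0)"
proof -
  obtain q where q: "m + 1 = c ^ i * q" using assms by blast
  then obtain r where r: "q = Suc r" by (cases q) auto
  have pos: "0 < c ^ i" using c_pos by simp
  have "m = (c ^ i - 1) + c ^ i * r" using q pos unfolding r mult_Suc_right by linarith
  then have "c ^ i * r \<le> m" "m < c ^ i * Suc r" using pos unfolding mult_Suc_right by linarith+
  then have 1: "m div c ^ i = r" by (rule div_nat_eqI)
  have 2: "(m + 1) div c ^ i = Suc r" using q r pos by simp
  have "c ^ Suc i dvd m + 1 \<longleftrightarrow> c dvd Suc r"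
    unfolding q r power_Suc2 by (rule nat_mult_dvd_cancel1[OF pos])
  then have 3: "c ^ Suc i dvd m + 1 \<longleftrightarrow> Suc r mod c = 0" by (simp add: dvd_eq_mod_eq_0)
  have 4: "Suc r mod c = (if Suc (r mod c) = c then 0 else Suc (r mod c))" by (rule mod_Suc)
  have "r mod c < c" using c_pos by simp
  then show "digit m i + 1 < c \<longleftrightarrow> \<not> c ^ Suc i dvd m + 1"
    "digit (m + 1) i = (if digit m i + 1 < c then digit m i + 1 else 0)"
    using 3 4 unfolding digit_def 1 2 by auto
qed

lemma digit_Suc_no_carry:
  assumes "\<not> c ^ i dvd m + 1"
  shows "digit (m + 1) i = digit m i" "\<not> c ^ Suc i dvd m + 1"
proof -
  have "(m + 1) mod c ^ i \<noteq> 0" using assms by (simp add: dvd_eq_mod_eq_0)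
  then have "(m + 1) div c ^ i = m div c ^ i" by (simp add: div_Suc)
  then show "digit (m + 1) i = digit m i" by (simp add: digit_def)
  show "\<not> c ^ Suc i dvd m + 1" using assms by (metis dvd_mult_right power_Suc)
qed

lemma runs_increment:
  assumes "represents M S (digit m)" "base R" "k < n"
  shows "runs increment R M (increment_time n) (\<lambda>R' M'. represents M' S (digit (m + 1)) \<and>
    same_outside {5, 6, 7, 11, 12, 13} R R' \<and> R' 13 = of_bool (c ^ k dvd m + 1))"
  unfolding increment_def
proof (rule runs_Seq_Const)
  let ?U = "{5, 6, 7, 11, 12, 13} :: nat set"
  \<comment> \<open>During the loop the string is mixed: positions below \<open>i\<close> already
    belong to \<open>m + 1\<close>, the others still to \<open>m\<close>. The carry is expressed by
    divisibility, which holds trivially for \<open>c ^ 0\<close>.\<close>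
  let ?d = "\<lambda>i t. if t < i then digit (m + 1) t else digit m t"
  let ?I = "\<lambda>i R' M'. represents M' S (?d i) \<and> same_outside ?U R R' \<and> R' 13 = of_bool (c ^ i dvd m + 1)"
  let ?T = "addr_time n + 5"
  have k: "R 1 = k" using assms(2) by (simp add: base_def)
  show "runs (For 12 1 (IfLess 2 13
     (Seq (addr 3 12) (Seq (Load 11 5) (Seq (Inc 11)
       (IfLess 11 4 (Seq (Store 5 11) (Const 13 0)) (Store 5 2))))) Skip)) (R(13 := 1)) M (n * (?T + 3) + 2)
     (\<lambda>R' M'. represents M' S (digit (m + 1)) \<and> same_outside ?U R R' \<and> R' 13 = of_bool (c ^ k dvd m + 1))"
  proof (rule runs_For[where P = ?I and T = "?T + 1"])
    show "?I 0 ((R(13 := 1))(12 := 0)) M" using assms(1) by simp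
    have "k * (?T + 3) \<le> n * (?T + 3)" using assms(3) by (intro mult_le_mono1) simp
    then show "(R(13 := 1)) 1 * (?T + 1 + 2) + 2 \<le> n * (?T + 3) + 2" using k by simp
  next
    fix R' M' assume *: "?I ((R(13 := 1)) 1) R' M'"
    then have "represents M' S (digit (m + 1))" using k unfolding represents_def by simp
    then show "represents M' S (digit (m + 1)) \<and> same_outside ?U R R' \<and> R' 13 = of_bool (c ^ k dvd m + 1)"
      using * k by simp
  next
    fix i R1 M1 assume i: "i < (R(13 := 1)) 1" "?I i R1 M1" "R1 12 = i" "R1 1 = (R(13 := 1)) 1"
    have ik: "i < k" using i(1) k by simp
    have b1: "base R1" using i(2) by (intro base_same_outside[OF assms(2), of ?U]) auto
    have upd: "(?d i)(i := digit (m + 1) i) = ?d (Suc i)" by (auto simp: fun_eq_iff less_Suc_eq)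
    let ?Q = "\<lambda>R'' M''. R'' 12 = i \<and> R'' 1 = (R(13 := 1)) 1 \<and> ?I (Suc i) (R''(12 := Suc i)) M''"
    show "runs (IfLess 2 13 (Seq (addr 3 12) (Seq (Load 11 5) (Seq (Inc 11)
       (IfLess 11 4 (Seq (Store 5 11) (Const 13 0)) (Store 5 2))))) Skip) R1 M1 (?T + 1) ?Q"
    proof (rule runs_If[where T = ?T])
      assume "R1 2 < R1 13"
      then have carry: "c ^ i dvd m + 1" using i b1 by (auto simp: base_def split: if_splits)
      show "runs (Seq (addr 3 12) (Seq (Load 11 5) (Seq (Inc 11)
       (IfLess 11 4 (Seq (Store 5 11) (Const 13 0)) (Store 5 2))))) R1 M1 ?T ?Q"
      proof (rule runs_Seq_addr[where n = n and Tb = 5])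
        fix R2 assume R2: "R2 5 = R1 3 * n + R1 12" "same_outside {5, 6, 7} R1 R2"
        then have a: "R2 5 = (n + 1) * n + i" using b1 i by (simp add: base_def)
        then have d: "M1 (R2 5) = digit m i" using i(2) ik unfolding represents_def by simp
        have r: "represents (M1(R2 5 := digit (m + 1) i)) S (?d (Suc i))"
          unfolding a upd[symmetric] using i(2) ik assms(3) by (intro represents_digit) auto
        define R3 where "R3 = R2(11 := Suc (digit m i))"
        have 3: "same_outside ?U R R3" "R3 2 = 0" "R3 4 = c" "R3 12 = i" "R3 1 = k"
            "R3 11 = Suc (digit m i)" "R3 5 = R2 5" "R3 13 = 1"
          using R2(2) b1 i carry by (auto simp: same_outside_def base_def R3_def)
        have "runs (IfLess 11 4 (Seq (Store 5 11) (Const 13 0)) (Store 5 2)) R3 M1 3 ?Q"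
        proof (rule runs_If[where T = 2])
          assume "R3 11 < R3 4"
          then have "digit (m + 1) i = Suc (digit m i)" "\<not> c ^ Suc i dvd m + 1"
            using digit_Suc_carry[OF carry] 3 by auto
          then show "runs (Seq (Store 5 11) (Const 13 0)) R3 M1 2 ?Q"
            using 3 r k by (intro runs_Seq_Store[where Tb = 1] runs_Const) (simp_all del: power_Suc)
        next
          assume "\<not> R3 11 < R3 4"
          then have "digit (m + 1) i = 0" "c ^ Suc i dvd m + 1"
            using digit_Suc_carry[OF carry] 3 by auto
          then show "runs (Store 5 2) R3 M1 2 ?Q"
            using 3 r k by (intro runs_Store) (simp_all del: power_Suc)
        qed simp
        then show "runs (Seq (Load 11 5) (Seq (Inc 11)
            (IfLess 11 4 (Seq (Store 5 11) (Const 13 0)) (Store 5 2)))) R2 M1 5 ?Q"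
          unfolding R3_def by (intro runs_Seq_Load[where Tb = 4] runs_Seq_Inc[where Tb = 3]) (simp_all add: d)
      qed (use b1 in \<open>auto simp: base_def\<close>)
    next
      assume "\<not> R1 2 < R1 13"
      then have no_carry: "\<not> c ^ i dvd m + 1" using i b1 by (auto simp: base_def)
      have "?d i = ?d (Suc i)" unfolding upd[symmetric] using digit_Suc_no_carry(1)[OF no_carry] by auto
      then show "runs Skip R1 M1 ?T ?Q"
        using i digit_Suc_no_carry(2)[OF no_carry] no_carry by (intro runs_Skip) (simp_all del: power_Suc)
    qed simp
  qed simp
qed (simp add: increment_time_def)

section \<open>The loop over all branches\<close>

definition success :: "nat \<Rightarrow> bool" where
  "success m \<longleftrightarrow> pick (marks (digit m) k) = None"

text \<open>Only \<open>k\<close> digits are stored, so the invariant still makes sense for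
  \<open>m = c ^ k\<close>, where the string has wrapped around to zeros and the loop flag is
  off.\<close>

definition round_inv :: "nat \<Rightarrow> (nat \<Rightarrow> nat) \<Rightarrow> (nat \<Rightarrow> nat) \<Rightarrow> bool" where
  "round_inv m R M \<longleftrightarrow> (\<exists>S. represents M S (digit m)) \<and> base R \<and> R 14 = of_bool (m < c ^ k) \<and>
     R 15 = of_bool (\<exists>m'<m. success m')"

lemma runs_round:
  assumes "round_inv m R M" "m < c ^ k" "k < n"
  shows "runs round R M (round_time c n) (round_inv (m + 1))"
proof -
  let ?A = "{5, 6, 7, 8, 9, 10, 11, 12, 17} \<union> {20..<20 + c}"
  obtain S where S: "represents M S (digit m)" using assms(1) by (auto simp: round_inv_def)
  have b: "base R" using assms(1) by (simp add: round_inv_def)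
  \<comment> \<open>Since \<open>0 < m + 1 <= c ^ k\<close>, the only possible multiple is
    \<open>c ^ k\<close> itself: the counter overflows exactly at the last leaf.\<close>
  have "c ^ k dvd m + 1 \<longleftrightarrow> m + 1 = c ^ k"
    using assms(2) by (auto dest!: dvd_imp_le)
  then have dvd: "c ^ k dvd m + 1 \<longleftrightarrow> \<not> m + 1 < c ^ k" using assms(2) by linarith
  have succ: "(\<exists>m'<m + 1. success m') \<longleftrightarrow> (\<exists>m'<m. success m') \<or> success m"
    by (auto simp: less_Suc_eq)
  show ?thesis unfolding round_def
  proof (rule runs_Seq[OF runs_clear[OF S b assms(3)]])
    fix R1 M1 assume 1: "represents M1 {} (digit m) \<and> same_outside {5, 6, 7, 10} R R1"
    then have b1: "base R1" by (intro base_same_outside[OF b]) auto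
    show "runs (Seq attempt (Seq (IfLess 2 9 Skip (Const 15 1)) (Seq increment (IfLess 2 13 (Const 14 0) Skip))))
       R1 M1 (attempt_time c n + increment_time n + 4) (round_inv (m + 1))"
    proof (rule runs_Seq[OF runs_attempt[OF _ b1 assms(3)]])
      show "represents M1 {} (digit m)" "\<forall>i<k. digit m i < c" using 1 digit_less by auto
      fix R2 M2 assume "represents M2 (marks (digit m) k) (digit m) \<and> same_outside ?A R1 R2 \<and>
         reports R2 (pick (marks (digit m) k))"
      then have 2: "represents M2 (marks (digit m) k) (digit m)" "same_outside ?A R R2"
          "R2 9 = of_bool (\<not> success m)"
        using 1 by (auto simp: same_outside_def reports_def success_def)
      have b2: "base R2" using 2(2) by (intro base_same_outside[OF b]) auto
      have R2: "R2 14 = 1" "R2 15 = of_bool (\<exists>m'<m. success m')"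
        using 2(2) assms(1,2) by (auto simp: same_outside_def round_inv_def)
      show "runs (Seq (IfLess 2 9 Skip (Const 15 1)) (Seq increment (IfLess 2 13 (Const 14 0) Skip)))
         R2 M2 (increment_time n + 4) (round_inv (m + 1))"
      proof (rule runs_Seq[where Ta = 2 and Tb = "increment_time n + 2"
          and P = "\<lambda>R3 M3. M3 = M2 \<and> base R3 \<and> R3 14 = 1 \<and> R3 15 = of_bool (\<exists>m'<m + 1. success m')"])
        show "runs (IfLess 2 9 Skip (Const 15 1)) R2 M2 2
          (\<lambda>R3 M3. M3 = M2 \<and> base R3 \<and> R3 14 = 1 \<and> R3 15 = of_bool (\<exists>m'<m + 1. success m'))"
          unfolding succ using 2 b2 R2
          by (intro runs_If[where T = 1] runs_Skip runs_Const)
            (simp_all add: base_def del: of_bool_eq_1_iff split: if_splits)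
        fix R3 M3 assume "M3 = M2 \<and> base R3 \<and> R3 14 = 1 \<and> R3 15 = of_bool (\<exists>m'<m + 1. success m')"
        then have 3: "M3 = M2" "base R3" "R3 14 = 1" "R3 15 = of_bool (\<exists>m'<m + 1. success m')"
          by blast+
        show "runs (Seq increment (IfLess 2 13 (Const 14 0) Skip)) R3 M3 (increment_time n + 2) (round_inv (m + 1))"
        proof (rule runs_Seq[OF runs_increment[OF _ 3(2) assms(3)]])
          show "represents M3 (marks (digit m) k) (digit m)" unfolding 3(1) by (rule 2(1))
          fix R4 M4 assume "represents M4 (marks (digit m) k) (digit (m + 1)) \<and>
            same_outside {5, 6, 7, 11, 12, 13} R3 R4 \<and> R4 13 = of_bool (c ^ k dvd m + 1)"
          then have 4: "represents M4 (marks (digit m) k) (digit (m + 1))"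
              "same_outside {5, 6, 7, 11, 12, 13} R3 R4" "R4 13 = of_bool (\<not> m + 1 < c ^ k)"
            unfolding dvd by blast+
          have b4: "base R4" by (rule base_same_outside[OF 3(2) 4(2)]) simp
          have R4: "R4 14 = 1" "R4 15 = of_bool (\<exists>m'<m + 1. success m')"
            using 3(3,4) same_outsideD[OF 4(2), of 14] same_outsideD[OF 4(2), of 15] by simp_all
          have R4_2: "R4 2 = 0" using b4 by (simp add: base_def)
          show "runs (IfLess 2 13 (Const 14 0) Skip) R4 M4 2 (round_inv (m + 1))"
          proof (rule runs_If[where T = 1])
            assume "R4 2 < R4 13"
            then have "\<not> m + 1 < c ^ k" using R4_2 4(3) by (simp split: if_splits)
            then show "runs (Const 14 0) R4 M4 1 (round_inv (m + 1))"
              using 4(1) b4 R4(2) unfolding round_inv_def by (intro runs_Const) (auto simp: base_def)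
          next
            assume "\<not> R4 2 < R4 13"
            then have "m + 1 < c ^ k" using R4_2 4(3) by (simp split: if_splits)
            then show "runs Skip R4 M4 1 (round_inv (m + 1))"
              using 4(1) b4 R4 unfolding round_inv_def by (intro runs_Skip) auto
          qed simp
        qed simp
      qed simp
    qed (simp_all)
  qed (simp add: round_time_def)
qed

section \<open>Soundness and completeness of the search tree\<close>

lemma ex_digits:
  assumes "\<And>t. ds t < c"
  shows "\<exists>m<c ^ j. \<forall>t<j. digit m t = ds t"
proof (induction j)
  case 0
  then show ?case using c_pos by simp
next
  case (Suc j)
  then obtain m where m: "m < c ^ j" "\<forall>t<j. digit m t = ds t" by blast
  \<comment> \<open>A new leading digit at position \<open>j\<close> changes the quotient by
    \<open>c ^ t\<close>, for \<open>t < j\<close>, by a multiple of \<open>c\<close>; lower digits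
    are unaffected.\<close>
  let ?m = "m + c ^ j * ds j"
  have "?m < c ^ j * (ds j + 1)" using m(1) by simp
  also have "\<dots> \<le> c ^ j * c" using assms[of j] by (intro mult_le_mono2) simp
  finally have "?m < c ^ Suc j" by (simp add: mult.commute)
  moreover have "digit ?m t = ds t" if "t < Suc j" for t
  proof (cases "t = j")
    case True
    have "?m div c ^ j = ds j" using m(1) by (intro div_nat_eqI) auto
    then show ?thesis using assms[of j] True by (simp add: digit_def)
  next
    case False
    then have "t < j" using that by simp
    then obtain e where e: "j = t + Suc e" using less_imp_Suc_add[of t j] by auto
    have "c ^ j * ds j = c ^ t * (c * (c ^ e * ds j))" unfolding e by (simp add: power_add mult_ac)
    then have "?m div c ^ t = (m + c ^ t * (c * (c ^ e * ds j))) div c ^ t" by (simp only:)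
    also have "\<dots> = c * (c ^ e * ds j) + m div c ^ t" using c_pos by (intro div_mult_self2) simp
    finally have "?m div c ^ t = c * (c ^ e * ds j) + m div c ^ t" .
    then have "digit ?m t = digit m t" by (simp add: digit_def)
    then show ?thesis using m(2) False that by simp
  qed
  ultimately show ?case by blast
qed

lemma marks_cong: "(\<And>t. t < i \<Longrightarrow> ds t = ds' t) \<Longrightarrow> marks ds i = marks ds' i"
  by (induction i) auto

lemma marks_bound:
  assumes "\<And>t. ds t < c"
  shows "marks ds i \<subseteq> {..<n} \<and> finite (marks ds i) \<and> card (marks ds i) \<le> i"
proof (induction i)
  case (Suc i)
  show ?case
  proof (cases "pick (marks ds i)")
    case None
    then show ?thesis using Suc by (simp add: mark_step_def)
  next
    case (Some xs)
    have "xs ! ds i < n" using pick_SomeD(1,2)[OF Some] assms[of i] by (metis lessThan_iff nth_mem subsetD)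
    then show ?thesis using Suc Some by (simp add: mark_step_def card_insert_if)
  qed
qed simp

lemma pick_None_iff: "pick S = None \<longleftrightarrow> (\<forall>xs. length xs = c \<longrightarrow> set xs \<subseteq> {..<n} \<longrightarrow> \<not> bad S xs)"
  by (auto simp: pick_def find_None_iff set_tuples)

text \<open>\<open>T\<close> meets every bad tuple, so some digit selects an entry in
  \<open>T\<close>. That entry is unmarked because bad tuples avoid the marks; hence a branch inside
  \<open>T\<close> gains a vertex at every step until no bad tuple is left.\<close>

lemma ex_branch:
  assumes "pick T = None"
  shows "\<exists>ds. (\<forall>t. ds t < c) \<and> (pick (marks ds i) = None \<or> marks ds i \<subseteq> T \<and> card (marks ds i) = i)"
proof (induction i)
  case 0
  then show ?case using c_pos by (intro exI[of _ "\<lambda>_. 0"]) simp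
next
  case (Suc i)
  then obtain ds where ds: "\<forall>t. ds t < c" "pick (marks ds i) = None \<or> marks ds i \<subseteq> T \<and> card (marks ds i) = i"
    by blast
  show ?case
  proof (cases "pick (marks ds i)")
    case None
    then show ?thesis using ds(1) by (intro exI[of _ ds]) (simp add: mark_step_def)
  next
    case (Some xs)
    note xs = pick_SomeD[OF Some]
    have "\<not> bad T xs" using assms xs by (simp add: pick_None_iff)
    then obtain d where d: "d < c" "xs ! d \<in> T" using xs(3) by (auto simp: bad_def)
    have "xs ! d \<notin> marks ds i" using xs(3) d(1) by (simp add: bad_def)
    \<comment> \<open>The first \<open>i\<close> steps read only digits below \<open>i\<close>, so
      digit \<open>i\<close> is still free.\<close>
    moreover have "marks (ds(i := d)) (Suc i) = insert (xs ! d) (marks ds i)"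
      using marks_cong[of i "ds(i := d)" ds] Some by (simp add: mark_step_def)
    moreover have "finite (marks ds i)" using marks_bound[of ds i] ds(1) by simp
    ultimately have "marks (ds(i := d)) (Suc i) \<subseteq> T" "card (marks (ds(i := d)) (Suc i)) = Suc i"
      using ds(2) d(2) Some by (simp_all del: marks.simps)
    moreover have "\<forall>t. (ds(i := d)) t < c" using ds(1) d(1) by simp
    ultimately show ?thesis by blast
  qed
qed

lemma ex_success_iff: "(\<exists>m<c ^ k. success m) \<longleftrightarrow> (\<exists>S \<subseteq> {..<n}. card S \<le> k \<and> pick S = None)"
proof
  assume "\<exists>m<c ^ k. success m"
  then obtain m where "pick (marks (digit m) k) = None" by (auto simp: success_def)
  then show "\<exists>S \<subseteq> {..<n}. card S \<le> k \<and> pick S = None"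
    using marks_bound[of "digit m" k] digit_less by blast
next
  assume "\<exists>S \<subseteq> {..<n}. card S \<le> k \<and> pick S = None"
  then obtain S where S: "S \<subseteq> {..<n}" "card S \<le> k" "pick S = None" by blast
  obtain ds where ds: "\<And>t. ds t < c" "pick (marks ds k) = None \<or> marks ds k \<subseteq> S \<and> card (marks ds k) = k"
    using ex_branch[OF S(3)] by blast
  \<comment> \<open>A branch that has collected \<open>k\<close> vertices inside a set of at most
    \<open>k\<close> vertices has collected the whole set.\<close>
  have "marks ds k = S" if "marks ds k \<subseteq> S" "card (marks ds k) = k"
    using that S by (intro card_seteq) (auto intro: finite_subset)
  then have "pick (marks ds k) = None" using ds(2) S(3) by auto
  moreover obtain m where m: "m < c ^ k" "\<forall>t<k. digit m t = ds t" using ex_digits[of ds k, OF ds(1)] by blast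
  then have "marks (digit m) k = marks ds k" by (intro marks_cong) simp
  ultimately show "\<exists>m<c ^ k. success m" using m(1) by (auto simp: success_def)
qed

text \<open>The additive \<open>8\<close> consists of the outer test, five initialisations, the
  failing test of the loop and the final copy.\<close>

lemma runs_main:
  assumes "represents M {} (\<lambda>_. 0)" "k < n"
  shows "runs main ((\<lambda>_. 0)(0 := n, 1 := k)) M (c ^ k * (round_time c n + 1) + 8)
    (\<lambda>R' M'. R' 0 \<noteq> 0 \<longleftrightarrow> (\<exists>m<c ^ k. success m))"
proof -
  let ?R = "((\<lambda>_. 0)(0 := n, 1 := k)) :: nat \<Rightarrow> nat"
  let ?W = "c ^ k * (round_time c n + 1) + 1"
  let ?Q = "\<lambda>R' M'. R' 0 \<noteq> 0 \<longleftrightarrow> (\<exists>m<c ^ k. success m)"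
  let ?p = "Seq (WhileLess 2 14 round) (Copy 0 15)"
  have loop: "runs (WhileLess 2 14 round) R M ?W (round_inv (c ^ k))" if "round_inv 0 R M" for R
  proof (rule runs_While)
    fix i R M assume i: "i < c ^ k" "round_inv i R M"
    then have "R 2 < R 14" by (simp add: round_inv_def base_def)
    then show "R 2 < R 14 \<and> runs round R M (round_time c n) (round_inv (Suc i))"
      using runs_round[OF i(2,1) assms(2)] by simp
  qed (use that in \<open>auto simp: round_inv_def base_def\<close>)
  have "digit 0 = (\<lambda>_. 0)" by (simp add: digit_def fun_eq_iff)
  then have init: "round_inv 0 (?R(3 := n, 3 := Suc n, 4 := c, 16 := 1, 14 := 1)) M"
    using assms(1) c_pos by (auto simp: round_inv_def base_def)
  have last: "runs (Copy 0 15) R M' 1 ?Q" if "round_inv (c ^ k) R M'" for R M'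
    using that by (intro runs_Copy) (auto simp: round_inv_def)
  have p: "runs ?p (?R(3 := n, 3 := Suc n, 4 := c, 16 := 1, 14 := 1)) M (?W + 1) ?Q"
    by (rule runs_Seq[OF loop[OF init] last]) auto
  show ?thesis unfolding main_def
  proof (rule runs_If[where T = "?W + 6"])
    show "runs (Seq (Copy 3 0) (Seq (Inc 3) (Seq (Const 4 c) (Seq (Const 16 1) (Seq (Const 14 1) ?p))))) ?R M (?W + 6) ?Q"
      by (intro runs_Seq_Copy[where Tb = "?W + 5"] runs_Seq_Inc[where Tb = "?W + 4"])
        (rule runs_Seq_Const[where Tb = "?W + 3"], rule runs_Seq_Const[where Tb = "?W + 2"],
         rule runs_Seq_Const[where Tb = "?W + 1"], use p in simp_all)
  qed (use assms(2) in auto)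
qed

end

section \<open>The main theorem\<close>

text \<open>Discharges \<open>pat_cong\<close>: connectivity is taken within \<open>{..<c}\<close>,
  and pattern embeddings have their values there.\<close>

lemma bad_pattern_cong:
  assumes adj: "\<And>i j. i < c \<Longrightarrow> j < c \<Longrightarrow> adj i j = adj' i j"
    and eq: "\<And>i j. i < c \<Longrightarrow> j < c \<Longrightarrow> eq i j = eq' i j"
  shows "bad_pattern F1 F2 c adj eq = bad_pattern F1 F2 c adj' eq'"
proof -
  have "{(i, j). adj i j \<or> eq i j} \<inter> {..<c} \<times> {..<c} = {(i, j). adj' i j \<or> eq' i j} \<inter> {..<c} \<times> {..<c}"
    using adj eq by auto
  then have "conn {(i, j). adj i j \<or> eq i j} {..<c} = conn {(i, j). adj' i j \<or> eq' i j} {..<c}"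
    by (simp add: conn_def)
  moreover have "pattern_embeds H c adj eq \<phi> = pattern_embeds H c adj' eq' \<phi>" for H \<phi>
  proof (cases "\<phi> ` pverts H \<subseteq> {..<c}")
    case True
    then have "\<phi> u < c" if "u \<in> pverts H" for u using that by auto
    then show ?thesis using True adj eq by (simp add: pattern_embeds_def)
  qed (simp add: pattern_embeds_def)
  ultimately show ?thesis by (simp add: bad_pattern_def)
qed

text \<open>The program enumerates lists whereas the graph side speaks of functions; by
  \<open>pat_cong\<close> the values of \<open>f\<close> from \<open>c\<close> on are
  irrelevant.\<close>

lemma (in search_instance) pick_None_iff_tuple:
  "pick S = None \<longleftrightarrow> \<not> (\<exists>f. f ` {..<c} \<subseteq> {..<n} - S \<and> pat (\<lambda>i j. (f i, f j) \<in> E) (\<lambda>i j. f i = f j))"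
proof -
  have "(\<exists>xs. length xs = c \<and> set xs \<subseteq> {..<n} \<and> bad S xs) \<longleftrightarrow>
    (\<exists>f. f ` {..<c} \<subseteq> {..<n} - S \<and> pat (\<lambda>i j. (f i, f j) \<in> E) (\<lambda>i j. f i = f j))" (is "?L \<longleftrightarrow> ?R")
  proof
    assume ?L
    then obtain xs where xs: "length xs = c" "set xs \<subseteq> {..<n}" "bad S xs" by blast
    then have "xs ! i \<in> {..<n} - S" if "i < c" for i
    proof -
      have "xs ! i \<in> set xs" using that xs(1) by simp
      then show ?thesis using that xs(2,3) by (auto simp: bad_def)
    qed
    then have "(!) xs ` {..<c} \<subseteq> {..<n} - S" by auto
    then show ?R using xs(3) by (intro exI[of _ "(!) xs"]) (simp add: bad_def)
  next
    assume ?R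
    then obtain f where f: "f ` {..<c} \<subseteq> {..<n} - S" "pat (\<lambda>i j. (f i, f j) \<in> E) (\<lambda>i j. f i = f j)" by blast
    let ?xs = "map f [0..<c]"
    have "pat (\<lambda>i j. (?xs ! i, ?xs ! j) \<in> E) (\<lambda>i j. ?xs ! i = ?xs ! j) =
        pat (\<lambda>i j. (f i, f j) \<in> E) (\<lambda>i j. f i = f j)"
      by (rule pat_cong) auto
    then have "bad S ?xs" using f by (auto simp: bad_def)
    moreover have "set ?xs = f ` {..<c}" by (simp add: atLeast0LessThan)
    then have "set ?xs \<subseteq> {..<n}" using f(1) by blast
    ultimately show ?L by (intro exI[of _ ?xs]) simp
  qed
  then show ?thesis unfolding pick_None_iff by blast
qed

lemma (in search_instance) represents_input:
  assumes "k < n"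
  shows "represents (\<lambda>a. if a < n * n \<and> (a div n, a mod n) \<in> E then 1 else 0) {} (\<lambda>_. 0)"
proof -
  have "x * n + y < n * n" if "x < n" "y < n" for x y
  proof -
    have "x * n + y < (x + 1) * n" using that by simp
    also have "\<dots> \<le> n * n" using that by (intro mult_le_mono1) simp
    finally show ?thesis .
  qed
  then show ?thesis by (simp add: represents_def)
qed

text \<open>Connected graphs are nonempty, so all three summands are positive and the truncated
  subtraction leaves at least one. Positivity makes \<open>c\<close> usable as a base for the digits
  and gives every tuple an entry.\<close>

lemma forbidden_order_pos:
  assumes "finite F1" "finite F2" "F1 \<noteq> {}" "F2 \<noteq> {}"
    and "forbidden_family \<P>1 F1" "forbidden_family \<P>2 F2"
    and "\<forall>H \<in> F1 \<union> F2. connected (with_proj H)"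
    and "\<exists>H \<in> F1. isomorphic H (path_graph \<alpha>)"
  shows "0 < max_order F1 + max_order F2 + \<alpha> - 2"
proof -
  have ne: "finite (pverts H) \<and> pverts H \<noteq> {}" if "H \<in> F1 \<union> F2" for H
  proof -
    have "pair_graph H" using assms(5,6) that by (auto simp: forbidden_family_def)
    then show ?thesis
      using pair_graph_arcs(1) connected_iff_conn[of H] assms(7) that by (auto simp: conn_def)
  qed
  have "0 < max_order F" if F: "F = F1 \<or> F = F2" for F
  proof -
    obtain H where H: "H \<in> F" using F assms(3,4) by auto
    then have "0 < card (pverts H)" using ne[of H] F by (auto simp: card_gt_0_iff)
    also have "card (pverts H) \<le> max_order F"
      using F H assms(1,2) unfolding max_order_def by (intro Max_ge) auto
    finally show ?thesis .
  qed
  then have "0 < max_order F1" "0 < max_order F2" by auto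
  moreover have "0 < \<alpha>"
  proof -
    obtain H f where "H \<in> F1" "bij_betw f (pverts H) {..<\<alpha>}"
      using assms(8) isomorphic_ex_map[of _ "path_graph \<alpha>"] by (fastforce simp: path_graph_def)
    then have "{..<\<alpha>} \<noteq> {}" using ne[of H] by (auto simp: bij_betw_def)
    then show ?thesis by (cases \<alpha>) auto
  qed
  ultimately show ?thesis by linarith
qed

theorem theorem1:
  fixes \<P>1 \<P>2 F1 F2 :: "ugraph set" and \<alpha> d1 d2 c :: nat
  assumes "graph_class \<P>1" "graph_class \<P>2"
    and "hereditary \<P>1" "hereditary \<P>2"
    and "forbidden_family \<P>1 F1" "forbidden_family \<P>2 F2"
    and "finite F1" "finite F2" "F1 \<noteq> {}" "F2 \<noteq> {}"
    and "\<forall>H \<in> F1 \<union> F2. connected (with_proj H)"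
    and "\<exists>H \<in> F1. isomorphic H (path_graph \<alpha>)"
    and "d1 = max_order F1" "d2 = max_order F2"
    and "c = d1 + d2 + \<alpha> - 2"
  shows "\<exists>p a b. decides_in_time p (deletable \<P>1 \<P>2) (\<lambda>n k. a * c ^ k * (n + 1) ^ b)"
proof -
  have c: "c = max_order F1 + max_order F2 + \<alpha> - 2" using assms(13-15) by simp
  have "0 < c" unfolding c
    using assms(7-10,5,6,11,12) by (rule forbidden_order_pos)
  interpret search "bad_pattern F1 F2 c" c
    by unfold_locales (rule bad_pattern_cong, assumption+, rule \<open>0 < c\<close>)
  \<comment> \<open>Since \<open>1 <= c ^ k\<close>, the additive \<open>8\<close> can be moved
    under the factor \<open>c ^ k\<close>, where it joins the \<open>1\<close> paid per loop
    test.\<close>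
  have "poly_bounded (\<lambda>n. round_time c n + 9)"
    by (intro poly_bounded_intros poly_bounded_round_time)
  then obtain a b where ab: "\<And>n. round_time c n + 9 \<le> a * (n + 1) ^ b"
    by (auto simp: poly_bounded_def)
  have "decides_in_time main (deletable \<P>1 \<P>2) (\<lambda>n k. a * c ^ k * (n + 1) ^ b)"
    unfolding decides_in_time_def
  proof (intro allI impI)
    fix G :: ugraph and n k :: nat assume G: "pair_graph G \<and> pverts G = {..<n}"
    let ?M = "\<lambda>x. if x < n * n \<and> (x div n, x mod n) \<in> parcs G then 1 else 0"
    have "c ^ k * (round_time c n + 9) \<le> c ^ k * (a * (n + 1) ^ b)" using ab by (rule mult_le_mono2)
    then have time: "c ^ k * (round_time c n + 9) \<le> a * c ^ k * (n + 1) ^ b" by (simp only: mult_ac)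
    have ck: "1 \<le> c ^ k" using \<open>0 < c\<close> by simp
    have "runs main ((\<lambda>_. 0)(0 := n, 1 := k)) ?M (c ^ k * (round_time c n + 9))
        (\<lambda>R' M'. R' 0 \<noteq> 0 \<longleftrightarrow> deletable \<P>1 \<P>2 G k)"
    proof (cases "k < n")
      case True
      interpret search_instance "bad_pattern F1 F2 c" c n k "parcs G" ..
      have "(\<exists>m<c ^ k. success m) \<longleftrightarrow> deletable \<P>1 \<P>2 G k"
        using G deletable_iff[OF assms(5-8,11,12) c, of G k]
        by (simp add: ex_success_iff pick_None_iff_tuple)
      moreover have "c ^ k * (round_time c n + 1) + 8 \<le> c ^ k * (round_time c n + 9)"
        using ck by (simp add: algebra_simps)
      ultimately show ?thesis
        using runs_mono[OF runs_main[OF represents_input[OF True] True]] by simp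
    next
      case False
      \<comment> \<open>A tuple has at least one entry, so none avoids the full vertex set.\<close>
      have "f ` {..<c} \<noteq> {}" for f :: "nat \<Rightarrow> nat" using \<open>0 < c\<close> by (simp add: lessThan_empty_iff)
      then have "\<not> (\<exists>f. f ` {..<c} \<subseteq> pverts G - {..<n} \<and> tuple_pattern F1 F2 c (parcs G) f)"
        using G by simp
      then have "deletable \<P>1 \<P>2 G k"
        unfolding deletable_iff[OF assms(5-8,11,12) c conjunct1[OF G]]
        using G False by (intro exI[of _ "{..<n}"]) simp
      moreover have "1 * (0 + 9) \<le> c ^ k * (round_time c n + 9)" using ck by (intro mult_le_mono) auto
      ultimately show ?thesis
        unfolding main_def using False by (intro runs_If[where T = 1] runs_Const) auto
    qed
    then obtain t R' M' where run: "exec main ((\<lambda>_. 0)(0 := n, 1 := k), ?M) t (R', M')"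
        "t \<le> c ^ k * (round_time c n + 9)" "R' 0 \<noteq> 0 \<longleftrightarrow> deletable \<P>1 \<P>2 G k"
      by (auto simp: runs_def)
    then show "\<exists>t s. exec main (input_state G n k) t s \<and> t \<le> a * c ^ k * (n + 1) ^ b \<and>
        (accepting s \<longleftrightarrow> deletable \<P>1 \<P>2 G k)"
      using order_trans[OF run(2) time] run(1,3) unfolding input_state_def accepting_def
      by (intro exI[of _ t] exI[of _ "(R', M')"]) (simp only: fst_conv)
  qed
  then show ?thesis by blast
qed

end
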